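(* Let $A\in\mathbb{R}^{n\times n}$ be nonsingular and $b\in\mathbb{R}^n$. Assume that preconditioned sketched GMRES is restarted every $m$ iterations (restarted scheme described in the context) with a randomized subspace embedding $S\in\mathbb{R}^{s\times n}$ with distortion $\epsilon\in(0,1)$ for $m$-dimensional subspaces of $\mathbb{R}^n$, in the sense that the embedding inequality of the context holds with high probability. Assume also that for each restart index $i\ge1$ there exists $k^{(i)}\le m$ such that the computed quantities of the $i$-th cycle, with computed preconditioned basis $\hat Z^{(i)}_{1:k^{(i)}}\in\mathbb{R}^{n\times k^{(i)}}$, satisfy the rounding error model (W), (b), (C), (g), (LS), (x) of the context with parameters $\varepsilon_W^{(i)},\varepsilon_b^{(i)},\varepsilon_{sls}^{(i)},\varepsilon_S^{(i)},\varepsilon_x^{(i)}\le O(u)$, and that $$O(u)\sqrt{\tfrac{1-\epsilon}{1+\epsilon}}\;\kappa\bigl([\phi\,\hat b^{(i)},\ \hat W^{(i)}_{1:k^{(i)}}]\bigr)\ge1\ \text{ for all }\phi>0,\qquad O(u)\sqrt{\tfrac{1+\epsilon}{1-\epsilon}}\;\kappa(\hat W^{(i)}_{1:k^{(i)}})\le\tfrac12,\qquad O(u)\,\kappa(\hat Z^{(i)}_{1:k^{(i)}})\le\tfrac12 .$$ If $$\Lambda_1^{(i)}=\frac{1+\epsilon}{1-\epsilon}\,O(u)\,\kappa(M_L)\bigl(1+\bar\tau_{k^{(i)}}\bigr)\ll1\qquad\text{with}\qquad \bar\tau_{k^{(i)}}=\frac{\|\hat Z^{(i)}_{1:k^{(i)}}\|\,\|A\|_F\,\|\hat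 y^{(k^{(i)})}\|}{\|A\hat d^{(i)}\|}$$ holds for $i$, then, with high probability, the backward error $\|b-A\hat x\|/(\|A\|_F\|\hat x\|+\|b\|)$ of the computed approximation is reduced in the $i$-th restart cycle by a factor $\Lambda_1^{(i)}$ until it holds that $$\frac{\|b-A\hat x\|}{\|A\|_F\|\hat x\|+\|b\|}\le O(u).$$
   Context: Notation. $\|\cdot\|$ is the Euclidean vector norm and the induced spectral matrix norm, $\|\cdot\|_F$ the Frobenius norm. $\sigma_{\min}(X)=\min_{\|v\|=1}\|Xv\|$, $\kappa(X)=\|X\|/\sigma_{\min}(X)$ (equal to $\infty$ if $\sigma_{\min}(X)=0$). $X_{1:k}$ denotes the first $k$ columns of $X$, and $X_j$ its $j$-th column. $u$ is the unit roundoff, and $O(u)$ denotes a quantity equal to (or bounded by) $u$ times a suitable low degree polynomial in the dimensions; different occurrences may involve different polynomials. "$\ll1$" means sufficiently small compared with $1$. Hats denote computed quantities. Embedding inequality. For $\epsilon\in(0,1)$, $S\in\mathbb{R}^{s\times n}$ is an $\epsilon$-subspace embedding for a subspace $\mathcal V\subseteq\mathbb{R}^n$ if $(1-\epsilon)\|v\|^2\le\|Sv\|^2\le(1+\epsilon)\|v\|^2$ for all $v\in\mathcal V$. $S$ is drawn at random and this holds with high probability for the subspaces the algorithm sketches. "With high probability" in the conclusion refers to the event that the embedding inequality holds on the span of the columns of $[\hat b^{(i)},\hat W^{(i)}_{1:k^{(i)}}]$ for the cycles concerned; the probability is not quantified. Restarted scheme (viewed as iterative refinement). With $M_L,M_R$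 nonsingular preconditioners, and current computed approximation $\hat x^{(i)}$: (i) compute the residual $r^{(i)}=b-A x^{(i)}$, the computed residual $\hat r^{(i)}$ satisfying $\|\hat r^{(i)}-(b-A\hat x^{(i)})\|\le O(u)(\|b\|+\|A\|_F\|\hat x^{(i)}\|)$; (ii) solve $Ad^{(i)}=\hat r^{(i)}$ approximately by one cycle of preconditioned sketched GMRES with zero initial guess, stopped at iteration $k^{(i)}$, giving the computed $\hat d^{(i)}$; (iii) update $x^{(i+1)}=x^{(i)}+d^{(i)}$, i.e. $\hat x^{(i+1)}$ is $\hat x^{(i)}+\hat d^{(i)}$ computed with the usual floating-point addition error of relative size $O(u)$. The backward error "is reduced in the $i$-th restart cycle by a factor $\Lambda_1^{(i)}$" means that the backward error of $\hat x^{(i+1)}$ is at most $\Lambda_1^{(i)}$ times that of $\hat x^{(i)}$, as long as the level $O(u)$ has not been reached. One cycle of preconditioned sketched GMRES for $Ad=\hat r^{(i)}$: (1) from a (not necessarily orthogonal) Krylov basis $B_{1:k}$ form $Z_{1:k}=M_R^{-1}B_{1:k}$ and $W_{1:k}=M_L^{-1}AZ_{1:k}$; (2) form $g=SM_L^{-1}\hat r^{(i)}$, $C_{1:k}=SW_{1:k}$ and solve $y^{(k)}=\arg\min_y\|g-C_{1:k}y\|$ by QR factorization; (3) set $d=Z_{1:k}y^{(k)}$. Rounding error model in cycle $i$ with $k=k^{(i)}$ (superscripts $(i)$ on the matrices, vectors and parameters suppressed where harmless): (W) $\hat W_{1:k}=M_L^{-1}A\hat Z_{1:k}+\Delta W_{1:k}$,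 $\|\Delta W_{1:k}\|_F\le\varepsilon_W\|M_L^{-1}\|\,\|A\|_F\,\|\hat Z_{1:k}\|_F$; (b) the computed preconditioned right-hand side is $\hat b^{(i)}=M_L^{-1}\hat r^{(i)}+\Delta b$, $\|\Delta b\|\le\varepsilon_b\|M_L^{-1}\|\,\|\hat r^{(i)}\|$; (C) $\hat C_{1:k}=S\hat W_{1:k}+\Delta C_{1:k}$, $\|\Delta C_j\|\le\varepsilon_S\|S\hat W_j\|$ for all $j\le k$; (g) $\hat g=S\hat b^{(i)}+\Delta g$, $\|\Delta g\|\le\varepsilon_S\|S\hat b^{(i)}\|$; (LS) $\hat y^{(k)}=\arg\min_y\|\hat g+\Delta\hat g-(\hat C_{1:k}+\Delta\hat C_{1:k})y\|$ with $\|[\Delta\hat g,\ \Delta\hat C_{1:k}]e_j\|\le\varepsilon_{sls}\|[\hat g,\ \hat C_{1:k}]e_j\|$ for all $j\le k+1$; (x) $\hat d^{(i)}=\hat Z_{1:k}\hat y^{(k)}+\Delta d$, $\|\Delta d\|\le\varepsilon_x\|\hat Z_{1:k}\|\,\|\hat y^{(k)}\|$.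
   Formalization: As stated the claim fails if ‖A‖_F‖x‖+‖b‖ collapses in a cycle. Until the level O(u), the residual norm is shown to drop by Λ_1 always, and the backward error if this scale shrinks by at most a prescribed constant factor ρ (O(u) may depend on ρ). *)

theory Defs
  imports
    "HOL-Probability.Probability_Measure"
    "Jordan_Normal_Form.Gauss_Jordan_Elimination"
    "Jordan_Normal_Form.VS_Connect"
begin

unbundle no vec_syntax and no inner_syntax

definition vnorm :: "real vec \<Rightarrow> real" where
  "vnorm v = sqrt (v \<bullet> v)"

definition fro_norm :: "real mat \<Rightarrow> real" where
  "fro_norm X = sqrt (\<Sum>i<dim_row X. \<Sum>j<dim_col X. (X $$ (i, j))\<^sup>2)"

definition unit_vecs :: "nat \<Rightarrow> real vec set" where
  "unit_vecs k = {v \<in> carrier_vec k. vnorm v = 1}"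

definition spec_norm :: "real mat \<Rightarrow> real" where
  "spec_norm X = (SUP v\<in>unit_vecs (dim_col X). vnorm (X *\<^sub>v v))"

definition sigma_min :: "real mat \<Rightarrow> real" where
  "sigma_min X = (INF v\<in>unit_vecs (dim_col X). vnorm (X *\<^sub>v v))"

definition kappa :: "real mat \<Rightarrow> ereal" where
  "kappa X = (if sigma_min X = 0 then \<infinity> else ereal (spec_norm X / sigma_min X))"

definition minv :: "real mat \<Rightarrow> real mat" where
  "minv M = the (mat_inverse M)"

text \<open>The matrix \<open>[v, X]\<close>, with \<open>v\<close> prepended as column 0.\<close>

definition aug :: "real vec \<Rightarrow> real mat \<Rightarrow> real mat" where
  "aug v X = mat_of_cols (dim_vec v) (v # cols X)"

definition subspace_embedding :: "real \<Rightarrow> real mat \<Rightarrow> real vec set \<Rightarrow> bool" where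
  "subspace_embedding \<epsilon> S V \<longleftrightarrow>
     (\<forall>v\<in>V. (1 - \<epsilon>) * (vnorm v)\<^sup>2 \<le> (vnorm (S *\<^sub>v v))\<^sup>2 \<and>
            (vnorm (S *\<^sub>v v))\<^sup>2 \<le> (1 + \<epsilon>) * (vnorm v)\<^sup>2)"

text \<open>\<open>Q\<close> holds with probability at least \<open>1 - \<eta>\<close>; the inner event makes sense of this also
  when the set of all \<open>\<omega>\<close> satisfying \<open>Q\<close> is not measurable.\<close>

definition with_prob :: "'w measure \<Rightarrow> real \<Rightarrow> ('w \<Rightarrow> bool) \<Rightarrow> bool" where
  "with_prob P \<eta> Q \<longleftrightarrow> (\<exists>E\<in>sets P. 1 - \<eta> \<le> measure P E \<and> (\<forall>\<omega>\<in>E. Q \<omega>))"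

text \<open>Polynomials of degree at most \<open>d\<close>, with nonnegative coefficients, in the dimensions
  \<open>n\<close> (order of the system), \<open>s\<close> (sketch size) and \<open>m\<close> (restart length).  A bound \<open>O(u)\<close> is
  \<open>u * p n s m\<close> with such a \<open>p\<close>.\<close>

inductive dim_poly :: "nat \<Rightarrow> (nat \<Rightarrow> nat \<Rightarrow> nat \<Rightarrow> real) \<Rightarrow> bool" where
  dim_poly_const: "0 \<le> c \<Longrightarrow> dim_poly 0 (\<lambda>n s m. c)"
| dim_poly_n: "dim_poly 1 (\<lambda>n s m. real n)"
| dim_poly_s: "dim_poly 1 (\<lambda>n s m. real s)"
| dim_poly_m: "dim_poly 1 (\<lambda>n s m. real m)"
| dim_poly_add: "dim_poly d p \<Longrightarrow> dim_poly d q \<Longrightarrow> dim_poly d (\<lambda>n s m. p n s m + q n s m)"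
| dim_poly_mult: "dim_poly d p \<Longrightarrow> dim_poly e q \<Longrightarrow> dim_poly (d + e) (\<lambda>n s m. p n s m * q n s m)"
| dim_poly_weaken: "dim_poly d p \<Longrightarrow> d \<le> e \<Longrightarrow> dim_poly e p"

definition residual :: "real mat \<Rightarrow> real vec \<Rightarrow> real vec \<Rightarrow> real vec" where
  "residual A b x = b - A *\<^sub>v x"

definition residual_scale :: "real mat \<Rightarrow> real vec \<Rightarrow> real vec \<Rightarrow> real" where
  "residual_scale A b x = fro_norm A * vnorm x + vnorm b"

text \<open>The backward errors of successive iterates have different denominators
  \<open>residual_scale\<close>.  A cycle started from an iterate of huge norm can reduce the residual by
  the expected factor and still leave a larger backward error, since the computed residual is
  only accurate relative to the old scale; hence statements comparing the backward errors of
  \<open>x\<close> and \<open>x'\<close> have to bound the decrease of this scale.\<close>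

definition backward_error :: "real mat \<Rightarrow> real vec \<Rightarrow> real vec \<Rightarrow> real" where
  "backward_error A b x = vnorm (residual A b x) / residual_scale A b x"

text \<open>The computed quantities of one restart cycle, run for \<open>steps\<close> iterations:
  \<open>r\<close> the computed residual, \<open>Z\<close> and \<open>W\<close> the computed bases (first \<open>steps\<close> columns),
  \<open>bp\<close> the computed preconditioned right-hand side, \<open>C\<close> and \<open>g\<close> the computed sketches,
  \<open>y\<close> the computed least squares solution and \<open>d\<close> the computed correction.\<close>

record sgmres_cycle =
  steps :: nat
  r_hat :: "real vec"
  Z_hat :: "real mat"
  W_hat :: "real mat"
  bp_hat :: "real vec"
  C_hat :: "real mat"
  g_hat :: "real vec"
  y_hat :: "real vec"
  d_hat :: "real vec"

definition cycle_dims :: "nat \<Rightarrow> nat \<Rightarrow> nat \<Rightarrow> sgmres_cycle \<Rightarrow> bool" where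
  "cycle_dims n s m c \<longleftrightarrow>
     1 \<le> steps c \<and> steps c \<le> m \<and>
     r_hat c \<in> carrier_vec n \<and>
     Z_hat c \<in> carrier_mat n (steps c) \<and>
     W_hat c \<in> carrier_mat n (steps c) \<and>
     bp_hat c \<in> carrier_vec n \<and>
     C_hat c \<in> carrier_mat s (steps c) \<and>
     g_hat c \<in> carrier_vec s \<and>
     y_hat c \<in> carrier_vec (steps c) \<and>
     d_hat c \<in> carrier_vec n"

text \<open>Steps (i) and (iii) of iterative refinement, from the iterate \<open>x\<close> to \<open>x'\<close>, with rounding
  errors at level \<open>\<theta>\<close>.\<close>

definition refinement_step ::
  "real \<Rightarrow> real mat \<Rightarrow> real vec \<Rightarrow> real vec \<Rightarrow> sgmres_cycle \<Rightarrow> real vec \<Rightarrow> bool" where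
  "refinement_step \<theta> A b x c x' \<longleftrightarrow>
     vnorm (r_hat c - residual A b x) \<le> \<theta> * (vnorm b + fro_norm A * vnorm x) \<and>
     vnorm (x' - (x + d_hat c)) \<le> \<theta> * vnorm (x + d_hat c)"

definition model_W :: "real \<Rightarrow> real mat \<Rightarrow> real mat \<Rightarrow> sgmres_cycle \<Rightarrow> bool" where
  "model_W \<epsilon>\<^sub>W A M\<^sub>L c \<longleftrightarrow>
     (\<exists>\<Delta>W \<in> carrier_mat (dim_row A) (steps c).
        W_hat c = minv M\<^sub>L * A * Z_hat c + \<Delta>W \<and>
        fro_norm \<Delta>W \<le> \<epsilon>\<^sub>W * spec_norm (minv M\<^sub>L) * fro_norm A * fro_norm (Z_hat c))"

definition model_b :: "real \<Rightarrow> real mat \<Rightarrow> sgmres_cycle \<Rightarrow> bool" where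
  "model_b \<epsilon>\<^sub>b M\<^sub>L c \<longleftrightarrow>
     (\<exists>\<Delta>b \<in> carrier_vec (dim_row M\<^sub>L).
        bp_hat c = minv M\<^sub>L *\<^sub>v r_hat c + \<Delta>b \<and>
        vnorm \<Delta>b \<le> \<epsilon>\<^sub>b * spec_norm (minv M\<^sub>L) * vnorm (r_hat c))"

definition model_C :: "real \<Rightarrow> real mat \<Rightarrow> sgmres_cycle \<Rightarrow> bool" where
  "model_C \<epsilon>\<^sub>S S c \<longleftrightarrow>
     (\<exists>\<Delta>C \<in> carrier_mat (dim_row S) (steps c).
        C_hat c = S * W_hat c + \<Delta>C \<and>
        (\<forall>j<steps c. vnorm (col \<Delta>C j) \<le> \<epsilon>\<^sub>S * vnorm (S *\<^sub>v col (W_hat c) j)))"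

definition model_g :: "real \<Rightarrow> real mat \<Rightarrow> sgmres_cycle \<Rightarrow> bool" where
  "model_g \<epsilon>\<^sub>S S c \<longleftrightarrow>
     (\<exists>\<Delta>g \<in> carrier_vec (dim_row S).
        g_hat c = S *\<^sub>v bp_hat c + \<Delta>g \<and>
        vnorm \<Delta>g \<le> \<epsilon>\<^sub>S * vnorm (S *\<^sub>v bp_hat c))"

definition model_LS :: "real \<Rightarrow> real mat \<Rightarrow> sgmres_cycle \<Rightarrow> bool" where
  "model_LS \<epsilon>\<^sub>l\<^sub>s S c \<longleftrightarrow>
     (\<exists>\<Delta>g \<in> carrier_vec (dim_row S). \<exists>\<Delta>C \<in> carrier_mat (dim_row S) (steps c).
        is_arg_min (\<lambda>y. vnorm ((g_hat c + \<Delta>g) - (C_hat c + \<Delta>C) *\<^sub>v y))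
          (\<lambda>y. y \<in> carrier_vec (steps c)) (y_hat c) \<and>
        (\<forall>j<steps c + 1.
           vnorm (col (aug \<Delta>g \<Delta>C) j) \<le> \<epsilon>\<^sub>l\<^sub>s * vnorm (col (aug (g_hat c) (C_hat c)) j)))"

definition model_x :: "real \<Rightarrow> sgmres_cycle \<Rightarrow> bool" where
  "model_x \<epsilon>\<^sub>x c \<longleftrightarrow>
     (\<exists>\<Delta>d \<in> carrier_vec (dim_vec (d_hat c)).
        d_hat c = Z_hat c *\<^sub>v y_hat c + \<Delta>d \<and>
        vnorm \<Delta>d \<le> \<epsilon>\<^sub>x * spec_norm (Z_hat c) * vnorm (y_hat c))"

definition rounding_model ::
  "real \<Rightarrow> real mat \<Rightarrow> real mat \<Rightarrow> real mat \<Rightarrow> sgmres_cycle \<Rightarrow> bool" where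
  "rounding_model \<theta> A M\<^sub>L S c \<longleftrightarrow>
     (\<exists>\<epsilon>\<^sub>W \<epsilon>\<^sub>b \<epsilon>\<^sub>l\<^sub>s \<epsilon>\<^sub>S \<epsilon>\<^sub>x.
        \<epsilon>\<^sub>W \<le> \<theta> \<and> \<epsilon>\<^sub>b \<le> \<theta> \<and> \<epsilon>\<^sub>l\<^sub>s \<le> \<theta> \<and> \<epsilon>\<^sub>S \<le> \<theta> \<and> \<epsilon>\<^sub>x \<le> \<theta> \<and>
        model_W \<epsilon>\<^sub>W A M\<^sub>L c \<and> model_b \<epsilon>\<^sub>b M\<^sub>L c \<and> model_C \<epsilon>\<^sub>S S c \<and> model_g \<epsilon>\<^sub>S S c \<and>
        model_LS \<epsilon>\<^sub>l\<^sub>s S c \<and> model_x \<epsilon>\<^sub>x c)"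

text \<open>In \<^typ>\<open>ereal\<close>, a positive numerator over 0 is \<open>\<infinity>\<close>, and 0 over 0 is 0.\<close>

definition tau_bar :: "real mat \<Rightarrow> sgmres_cycle \<Rightarrow> ereal" where
  "tau_bar A c = ereal (spec_norm (Z_hat c) * fro_norm A * vnorm (y_hat c)) /
     ereal (vnorm (A *\<^sub>v d_hat c))"

text \<open>\<open>\<theta>\<close> is the value of the factor \<open>O(u)\<close>.\<close>

definition Lambda1 :: "real \<Rightarrow> real \<Rightarrow> real mat \<Rightarrow> real mat \<Rightarrow> sgmres_cycle \<Rightarrow> ereal" where
  "Lambda1 \<theta> \<epsilon> A M\<^sub>L c =
     ereal ((1 + \<epsilon>) / (1 - \<epsilon>) * \<theta>) * kappa M\<^sub>L * (1 + tau_bar A c)"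

end

theory Submission
  imports Defs
begin

text \<open>
  In each cycle the computed vector \<open>y\<close> minimizes exactly a least squares problem whose data are small
  columnwise perturbations of the sketch of \<open>[b, W]\<close>.  By assumption \<open>[\<phi> b, W]\<close> is numerically
  singular for every \<open>\<phi> > 0\<close> whereas \<open>W\<close> is well conditioned.  A near-null vector of
  \<open>[\<phi> b, W]\<close> must then involve the first column substantially, so \<open>b\<close> is nearly in the range
  of \<open>W\<close>.  The embedding carries this over to the sketched problem, the minimality of \<open>y\<close> selects
  it for \<open>y\<close>, and the embedding carries it back:  up to constants and the number of columns of \<open>W\<close>, the norm of
  \<open>b - W y\<close> is at most \<open>\<theta>\<close> times the square root of \<open>(1 + \<epsilon>) / (1 - \<epsilon>)\<close> times
  \<open>vnorm b + spec_norm W * vnorm y\<close>, where \<open>\<theta>\<close> is the level of the rounding errors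
  (\<open>sketched_least_squares_residual\<close>).  This needs nothing but triangle inequalities once
  \<open>\<phi>\<close> is chosen to balance the two terms.

  Multiplying by the left preconditioner gives a bound for \<open>r - A d\<close> with an additional factor
  \<open>kappa M\<^sub>L\<close>, relative to \<open>vnorm r + E\<close> with \<open>E = spec_norm Z * fro_norm A * vnorm y\<close>
  (\<open>correction_residual\<close>).  By definition \<open>E\<close> is \<open>tau_bar\<close> times \<open>vnorm (A d)\<close>, and \<open>A d\<close> is
  close to \<open>r\<close> as soon as the reduction factor is small.  The correction thus shrinks \<open>r\<close>
  by the factor \<open>2 \<mu>\<close>, where \<open>\<mu>\<close> is a small fraction of \<open>Lambda1\<close>
  (\<open>correction_residual_relative\<close>).

  What remains are the errors of the refinement step itself.  That of the computed residual is
  relative to the scale of the old iterate, but \<open>\<theta>\<close> times this scale is bounded by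
  \<open>\<theta>\<close> times the new scale plus a multiple of \<open>\<mu>\<close> times the residual, because the
  correction adds to the scale at most a multiple of \<open>E\<close>, and \<open>\<theta> E\<close> is in turn at most a
  multiple of \<open>\<mu> vnorm r\<close> (\<open>refined_residual\<close>).  So either the new residual is of
  the order of \<open>\<theta>\<close> times the new scale, which is the attainable level, or it is a small
  multiple of the old residual (\<open>backward_error_reduction\<close>).  All this happens on the event
  on which \<open>S\<close> is an embedding, so the probability is inherited from there.
\<close>

section \<open>Norms of vectors and matrices\<close>

lemma vnorm_eq_L2_set: "vnorm v = L2_set (\<lambda>i. v $ i) {..<dim_vec v}"
  unfolding vnorm_def L2_set_def scalar_prod_def
  by (simp add: power2_eq_square atLeast0LessThan)

lemma fro_norm_eq_L2_set:
  "fro_norm X = L2_set (\<lambda>i. L2_set (\<lambda>j. X $$ (i, j)) {..<dim_col X}) {..<dim_row X}"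
  unfolding fro_norm_def L2_set_def by (simp add: sum_nonneg)

lemma vnorm_nonneg [simp]: "0 \<le> vnorm v"
  by (simp add: vnorm_eq_L2_set)

lemma fro_norm_nonneg [simp]: "0 \<le> fro_norm X"
  by (simp add: fro_norm_eq_L2_set)

lemma vnorm_eq_0_iff: "v \<in> carrier_vec n \<Longrightarrow> vnorm v = 0 \<longleftrightarrow> v = 0\<^sub>v n"
  by (auto simp: vnorm_eq_L2_set L2_set_eq_0_iff)

lemma vnorm_zero [simp]: "vnorm (0\<^sub>v n) = 0"
  using vnorm_eq_0_iff[of "0\<^sub>v n" n] by simp

lemma vnorm_smult: "vnorm (a \<cdot>\<^sub>v v) = \<bar>a\<bar> * vnorm v"
  by (simp add: vnorm_eq_L2_set L2_set_def power_mult_distrib real_sqrt_mult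
      flip: sum_distrib_left)

lemma vnorm_triangle:
  assumes "v \<in> carrier_vec n" "w \<in> carrier_vec n"
  shows "vnorm (v + w) \<le> vnorm v + vnorm w"
proof -
  have "vnorm (v + w) = L2_set (\<lambda>i. v $ i + w $ i) {..<n}"
    using assms by (auto simp: vnorm_eq_L2_set intro!: L2_set_cong)
  then show ?thesis
    using L2_set_triangle_ineq[of "\<lambda>i. v $ i" "\<lambda>i. w $ i" "{..<n}"] assms
    by (simp add: vnorm_eq_L2_set)
qed

lemma vnorm_uminus [simp]: "vnorm (- v) = vnorm v"
  by (simp add: vnorm_eq_L2_set L2_set_def)

lemma vnorm_minus_commute:
  assumes "v \<in> carrier_vec n" "w \<in> carrier_vec n"
  shows "vnorm (v - w) = vnorm (w - v)"
proof -
  have "v - w = - (w - v)"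
    using assms by (intro eq_vecI) auto
  then show ?thesis
    by simp
qed

lemma vnorm_triangle_diff:
  assumes "v \<in> carrier_vec n" "w \<in> carrier_vec n"
  shows "vnorm (v - w) \<le> vnorm v + vnorm w"
proof -
  have "v - w = v + (- w)"
    using assms by (intro eq_vecI) auto
  then show ?thesis
    using vnorm_triangle[of v n "- w"] assms by simp
qed

lemma vnorm_le_diff:
  assumes "v \<in> carrier_vec n" "w \<in> carrier_vec n"
  shows "vnorm v \<le> vnorm w + vnorm (v - w)"
proof -
  have "v = w + (v - w)"
    using assms by (intro eq_vecI) auto
  then show ?thesis
    using vnorm_triangle[of w n "v - w"] assms by (metis minus_carrier_vec)
qed

lemma abs_index_le_vnorm: "i < dim_vec v \<Longrightarrow> \<bar>v $ i\<bar> \<le> vnorm v"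
  using member_le_L2_set[of "{..<dim_vec v}" i "\<lambda>i. \<bar>v $ i\<bar>"]
  by (simp add: vnorm_eq_L2_set L2_set_def)

text \<open>Rounding errors in sketches are bounded column by column, and this estimate turns such bounds
  into one for the action of the whole error matrix.\<close>

lemma vnorm_mult_mat_vec_le_sum:
  assumes X: "X \<in> carrier_mat n k" and v: "v \<in> carrier_vec k"
  shows "vnorm (X *\<^sub>v v) \<le> (\<Sum>j<k. vnorm (col X j) * \<bar>v $ j\<bar>)"
proof -
  have L2_sum: "L2_set (\<lambda>i. \<Sum>j\<in>J. f i j) {..<n} \<le> (\<Sum>j\<in>J. L2_set (\<lambda>i. f i j) {..<n})"
    if "finite J" for J :: "nat set" and f
    using that
  proof (induction J)
    case empty
    then show ?case by (simp add: L2_set_def)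
  next
    case (insert j J)
    then show ?case
      using L2_set_triangle_ineq[of "\<lambda>i. f i j" "\<lambda>i. \<Sum>j\<in>J. f i j" "{..<n}"] by simp
  qed
  have "vnorm (X *\<^sub>v v) = L2_set (\<lambda>i. \<Sum>j<k. X $$ (i, j) * v $ j) {..<n}"
    using X v by (auto simp: vnorm_eq_L2_set scalar_prod_def atLeast0LessThan intro!: L2_set_cong)
  also have "\<dots> \<le> (\<Sum>j<k. L2_set (\<lambda>i. X $$ (i, j) * v $ j) {..<n})"
    by (rule L2_sum) simp
  also have "\<dots> = (\<Sum>j<k. vnorm (v $ j \<cdot>\<^sub>v col X j))"
    using X by (auto simp: vnorm_eq_L2_set mult.commute intro!: sum.cong L2_set_cong)
  finally show ?thesis
    by (simp add: vnorm_smult mult.commute)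
qed

lemma vnorm_mult_mat_vec_le_fro:
  assumes X: "X \<in> carrier_mat n k" and v: "v \<in> carrier_vec k"
  shows "vnorm (X *\<^sub>v v) \<le> fro_norm X * vnorm v"
proof -
  have "vnorm (X *\<^sub>v v) = L2_set (\<lambda>i. \<bar>\<Sum>j<k. X $$ (i, j) * v $ j\<bar>) {..<n}"
    using X v by (auto simp: vnorm_eq_L2_set scalar_prod_def atLeast0LessThan L2_set_def)
  also have "\<dots> \<le> L2_set (\<lambda>i. L2_set (\<lambda>j. X $$ (i, j)) {..<k} * vnorm v) {..<n}"
  proof (rule L2_set_mono)
    fix i
    have "\<bar>\<Sum>j<k. X $$ (i, j) * v $ j\<bar> \<le> (\<Sum>j<k. \<bar>X $$ (i, j)\<bar> * \<bar>v $ j\<bar>)"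
      by (rule order_trans[OF sum_abs]) (simp add: abs_mult)
    then show "\<bar>\<Sum>j<k. X $$ (i, j) * v $ j\<bar> \<le> L2_set (\<lambda>j. X $$ (i, j)) {..<k} * vnorm v"
      using L2_set_mult_ineq[of "\<lambda>j. X $$ (i, j)" "\<lambda>j. v $ j" "{..<k}"] v
      by (simp add: vnorm_eq_L2_set)
  qed simp
  also have "\<dots> = fro_norm X * vnorm v"
    using X by (simp add: fro_norm_eq_L2_set L2_set_left_distrib)
  finally show ?thesis .
qed

lemma unit_vecs_nonempty:
  assumes "1 \<le> k" shows "unit_vecs k \<noteq> {}"
proof -
  have "vnorm (unit_vec k 0) = 1"
    using assms by (simp add: vnorm_def)
  then show ?thesis
    unfolding unit_vecs_def using unit_vec_carrier by blast
qed

lemma bdd_above_unit_vecs_image: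
  "bdd_above ((\<lambda>v. vnorm (X *\<^sub>v v)) ` unit_vecs (dim_col X))"
  unfolding unit_vecs_def
  by (rule bdd_aboveI2[of _ _ "fro_norm X"])
    (use vnorm_mult_mat_vec_le_fro[of X "dim_row X" "dim_col X"] in force)

lemma bdd_below_unit_vecs_image:
  "bdd_below ((\<lambda>v. vnorm (X *\<^sub>v v)) ` unit_vecs (dim_col X))"
  by (rule bdd_belowI2[of _ 0]) simp

lemma vnorm_mult_mat_vec_normalize:
  assumes X: "X \<in> carrier_mat n k" and v: "v \<in> carrier_vec k" "vnorm v \<noteq> 0"
  obtains w where "w \<in> unit_vecs k" "vnorm (X *\<^sub>v v) = vnorm v * vnorm (X *\<^sub>v w)"
proof
  let ?w = "(1 / vnorm v) \<cdot>\<^sub>v v"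
  show "?w \<in> unit_vecs k"
    using v by (simp add: unit_vecs_def vnorm_smult)
  show "vnorm (X *\<^sub>v v) = vnorm v * vnorm (X *\<^sub>v ?w)"
    using v by (simp add: mult_mat_vec[OF X v(1)] vnorm_smult)
qed

lemma vnorm_mult_mat_vec_le_spec:
  assumes X: "X \<in> carrier_mat n k" and v: "v \<in> carrier_vec k"
  shows "vnorm (X *\<^sub>v v) \<le> spec_norm X * vnorm v"
proof (cases "vnorm v = 0")
  case True
  then show ?thesis
    using vnorm_mult_mat_vec_le_fro[OF assms] by simp
next
  case False
  obtain w where w: "w \<in> unit_vecs k" "vnorm (X *\<^sub>v v) = vnorm v * vnorm (X *\<^sub>v w)"
    by (rule vnorm_mult_mat_vec_normalize[OF X v False])
  have "vnorm (X *\<^sub>v w) \<le> spec_norm X"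
    unfolding spec_norm_def using w X
    by (intro cSUP_upper[OF _ bdd_above_unit_vecs_image]) auto
  then show ?thesis
    by (simp add: w(2) mult.commute[of "spec_norm X"] mult_left_mono)
qed

lemma sigma_min_le_vnorm_mult_mat_vec:
  assumes X: "X \<in> carrier_mat n k" and v: "v \<in> carrier_vec k"
  shows "sigma_min X * vnorm v \<le> vnorm (X *\<^sub>v v)"
proof (cases "vnorm v = 0")
  case False
  obtain w where w: "w \<in> unit_vecs k" "vnorm (X *\<^sub>v v) = vnorm v * vnorm (X *\<^sub>v w)"
    by (rule vnorm_mult_mat_vec_normalize[OF X v False])
  have "sigma_min X \<le> vnorm (X *\<^sub>v w)"
    unfolding sigma_min_def using w X
    by (intro cINF_lower[OF bdd_below_unit_vecs_image]) auto
  then show ?thesis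
    by (simp add: w(2) mult.commute[of "sigma_min X"] mult_left_mono)
qed simp

lemma spec_norm_le:
  assumes X: "X \<in> carrier_mat n k" "1 \<le> k"
    and B: "\<And>v. v \<in> carrier_vec k \<Longrightarrow> vnorm v = 1 \<Longrightarrow> vnorm (X *\<^sub>v v) \<le> B"
  shows "spec_norm X \<le> B"
  unfolding spec_norm_def using X B unit_vecs_nonempty[of k]
  by (intro cSUP_least) (auto simp: unit_vecs_def)

lemma spec_norm_le_fro_norm:
  assumes "X \<in> carrier_mat n k" "1 \<le> k"
  shows "spec_norm X \<le> fro_norm X"
  using vnorm_mult_mat_vec_le_fro[OF assms(1)] by (intro spec_norm_le[OF assms]) force

lemma spec_norm_nonneg:
  assumes "X \<in> carrier_mat n k" "1 \<le> k"
  shows "0 \<le> spec_norm X"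
proof -
  obtain w where "w \<in> unit_vecs k"
    using unit_vecs_nonempty[OF assms(2)] by blast
  then show ?thesis
    using vnorm_mult_mat_vec_le_spec[OF assms(1), of w] vnorm_nonneg[of "X *\<^sub>v w"]
    unfolding unit_vecs_def by (simp del: vnorm_nonneg)
qed

lemma sigma_min_nonneg:
  assumes "X \<in> carrier_mat n k" "1 \<le> k"
  shows "0 \<le> sigma_min X"
  unfolding sigma_min_def using assms unit_vecs_nonempty[of k]
  by (intro cINF_greatest) auto

lemma sigma_min_le_spec_norm:
  assumes "X \<in> carrier_mat n k" "1 \<le> k"
  shows "sigma_min X \<le> spec_norm X"
proof -
  obtain w where "w \<in> unit_vecs k"
    using unit_vecs_nonempty[OF assms(2)] by blast
  then show ?thesis
    using vnorm_mult_mat_vec_le_spec[OF assms(1), of w]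
      sigma_min_le_vnorm_mult_mat_vec[OF assms(1), of w]
    unfolding unit_vecs_def by simp
qed

text \<open>A value above the infimum is attained approximately by some unit vector, so near-singularity
  yields a near-null vector without any compactness argument.\<close>

lemma sigma_min_less_obtain:
  assumes "X \<in> carrier_mat n k" "1 \<le> k" "sigma_min X < B"
  obtains v where "v \<in> carrier_vec k" "vnorm v = 1" "vnorm (X *\<^sub>v v) < B"
proof -
  have "\<exists>v\<in>unit_vecs k. vnorm (X *\<^sub>v v) < B"
    using assms unit_vecs_nonempty[of k] bdd_below_unit_vecs_image[of X]
      cINF_less_iff[of "unit_vecs k" "\<lambda>v. vnorm (X *\<^sub>v v)" B]
    unfolding sigma_min_def by simp
  then show thesis
    using that unfolding unit_vecs_def by blast
qed

lemma vnorm_col_le_spec_norm: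
  assumes X: "X \<in> carrier_mat n k" and j: "j < k"
  shows "vnorm (col X j) \<le> spec_norm X"
proof -
  have "vnorm (unit_vec k j) = 1"
    using j by (simp add: vnorm_def)
  moreover have "X *\<^sub>v unit_vec k j = col X j"
    using X j by (intro eq_vecI) auto
  ultimately show ?thesis
    using vnorm_mult_mat_vec_le_spec[OF X unit_vec_carrier, of j] by simp
qed

text \<open>The sharp constant is the square root of \<open>k\<close>; a factor polynomial in the dimensions is all that is
  needed below.\<close>

lemma fro_norm_le_spec_norm:
  assumes X: "X \<in> carrier_mat n k"
  shows "fro_norm X \<le> real k * spec_norm X"
proof -
  have "fro_norm X = L2_set (\<lambda>j. vnorm (col X j)) {..<k}"
  proof -
    have "(\<Sum>i<n. \<Sum>j<k. (X $$ (i, j))\<^sup>2) = (\<Sum>j<k. \<Sum>i<n. (X $$ (i, j))\<^sup>2)"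
      by (rule sum.swap)
    also have "\<dots> = (\<Sum>j<k. (vnorm (col X j))\<^sup>2)"
      using X by (auto simp: vnorm_eq_L2_set L2_set_def sum_nonneg intro!: sum.cong)
    finally show ?thesis
      using X by (simp add: fro_norm_def L2_set_def)
  qed
  also have "\<dots> \<le> (\<Sum>j<k. vnorm (col X j))"
    by (rule L2_set_le_sum) simp
  also have "\<dots> \<le> (\<Sum>j<k. spec_norm X)"
    using vnorm_col_le_spec_norm[OF X] by (intro sum_mono) simp
  finally show ?thesis
    by simp
qed

lemma aug_carrier:
  assumes "v \<in> carrier_vec n" "X \<in> carrier_mat n k"
  shows "aug v X \<in> carrier_mat n (Suc k)"
  using assms mat_of_cols_carrier(1)[of n "v # cols X"] by (simp add: aug_def)

lemma aug_mult_vCons: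
  assumes v: "v \<in> carrier_vec n" and X: "X \<in> carrier_mat n k" and w: "w \<in> carrier_vec k"
  shows "aug v X *\<^sub>v vCons a w = a \<cdot>\<^sub>v v + X *\<^sub>v w"
proof (rule eq_vecI)
  fix i assume "i < dim_vec (a \<cdot>\<^sub>v v + X *\<^sub>v w)"
  then have i: "i < n"
    using X by simp
  have row: "row (aug v X) i = vCons (v $ i) (row X i)"
  proof (rule eq_vecI)
    fix j assume "j < dim_vec (vCons (v $ i) (row X i))"
    then show "row (aug v X) i $ j = vCons (v $ i) (row X i) $ j"
      using i v X by (cases j) (auto simp: aug_def mat_of_cols_index)
  qed (use i v X in \<open>simp add: aug_def\<close>)
  show "(aug v X *\<^sub>v vCons a w) $ i = (a \<cdot>\<^sub>v v + X *\<^sub>v w) $ i"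
    using i v X by (simp add: row index_mult_mat_vec[of i "aug v X"] aug_def[of v X, THEN arg_cong[where f = dim_row]])
qed (use v X in \<open>simp add: aug_def\<close>)

lemma vnorm_vCons: "(vnorm (vCons a w))\<^sup>2 = a\<^sup>2 + (vnorm w)\<^sup>2"
proof -
  have "(vnorm v)\<^sup>2 = v \<bullet> v" for v
    by (simp add: vnorm_def scalar_prod_def sum_nonneg)
  then show ?thesis
    by (simp add: power2_eq_square)
qed

section \<open>Backward stable sketched least squares\<close>

text \<open>The error of each column is bounded relative to that column and is scaled along with it.  The
  perturbation of \<open>[a b, W]\<close> is therefore bounded relative to \<open>\<bar>a\<bar> vnorm b\<close> and \<open>spec_norm W\<close>
  separately, with no constant that depends on \<open>a\<close>.\<close>

lemma sketch_perturbation: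
  assumes W: "W \<in> carrier_mat n k" and b: "b \<in> carrier_vec n" and S: "S \<in> carrier_mat s n"
    and gt: "gt \<in> carrier_vec s" and Ct: "Ct \<in> carrier_mat s k" and w: "w \<in> carrier_vec k"
    and hi_b: "vnorm (S *\<^sub>v b) \<le> U * vnorm b"
    and hi_W: "\<And>j. j < k \<Longrightarrow> vnorm (S *\<^sub>v col W j) \<le> U * vnorm (col W j)"
    and err_g: "vnorm (gt - S *\<^sub>v b) \<le> \<zeta> * vnorm (S *\<^sub>v b)"
    and err_C: "\<And>j. j < k \<Longrightarrow> vnorm (col (Ct - S * W) j) \<le> \<zeta> * vnorm (S *\<^sub>v col W j)"
    and nonneg: "0 \<le> \<zeta>" "0 \<le> U"
  shows "vnorm ((a \<cdot>\<^sub>v gt + Ct *\<^sub>v w) - S *\<^sub>v (a \<cdot>\<^sub>v b + W *\<^sub>v w))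
    \<le> \<zeta> * U * (\<bar>a\<bar> * vnorm b + real k * spec_norm W * vnorm w)"
proof -
  have SW: "S * W \<in> carrier_mat s k" "(S * W) *\<^sub>v w = S *\<^sub>v (W *\<^sub>v w)"
    using S W w by auto
  have vecs: "S *\<^sub>v b \<in> carrier_vec s" "Ct *\<^sub>v w \<in> carrier_vec s"
      "S *\<^sub>v (W *\<^sub>v w) \<in> carrier_vec s" "W *\<^sub>v w \<in> carrier_vec n"
    using S W Ct w b by auto
  have "S *\<^sub>v (a \<cdot>\<^sub>v b + W *\<^sub>v w) = a \<cdot>\<^sub>v (S *\<^sub>v b) + S *\<^sub>v (W *\<^sub>v w)"
    using S b vecs by (simp add: mult_add_distrib_mat_vec mult_mat_vec)
  moreover have "(Ct - S * W) *\<^sub>v w = Ct *\<^sub>v w - S *\<^sub>v (W *\<^sub>v w)"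
    using minus_mult_distrib_mat_vec[OF Ct SW(1) w] SW(2) by simp
  ultimately have split: "(a \<cdot>\<^sub>v gt + Ct *\<^sub>v w) - S *\<^sub>v (a \<cdot>\<^sub>v b + W *\<^sub>v w)
      = a \<cdot>\<^sub>v (gt - S *\<^sub>v b) + (Ct - S * W) *\<^sub>v w"
    using vecs gt S Ct by (intro eq_vecI) (auto simp: algebra_simps)
  have E: "Ct - S * W \<in> carrier_mat s k"
    using SW(1) by (rule minus_carrier_mat)
  have "vnorm (gt - S *\<^sub>v b) \<le> \<zeta> * (U * vnorm b)"
    using err_g mult_left_mono[OF hi_b nonneg(1)] by linarith
  then have g_part: "vnorm (a \<cdot>\<^sub>v (gt - S *\<^sub>v b)) \<le> \<bar>a\<bar> * (\<zeta> * (U * vnorm b))"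
    by (simp add: vnorm_smult mult_left_mono)
  have "vnorm ((Ct - S * W) *\<^sub>v w) \<le> (\<Sum>j<k. vnorm (col (Ct - S * W) j) * \<bar>w $ j\<bar>)"
    by (rule vnorm_mult_mat_vec_le_sum[OF E w])
  also have "\<dots> \<le> (\<Sum>j<k. (\<zeta> * (U * spec_norm W)) * vnorm w)"
  proof (intro sum_mono mult_mono)
    fix j assume "j \<in> {..<k}"
    then have j: "j < k" by simp
    have "\<zeta> * vnorm (S *\<^sub>v col W j) \<le> \<zeta> * (U * spec_norm W)"
      using hi_W[OF j] vnorm_col_le_spec_norm[OF W j] nonneg
      by (meson mult_left_mono order_trans)
    then show "vnorm (col (Ct - S * W) j) \<le> \<zeta> * (U * spec_norm W)"
      using err_C[OF j] by linarith
    then show "0 \<le> \<zeta> * (U * spec_norm W)"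
      using order_trans[OF vnorm_nonneg] by blast
    show "\<bar>w $ j\<bar> \<le> vnorm w"
      using abs_index_le_vnorm[of j w] j w by simp
  qed simp
  finally have "vnorm ((Ct - S * W) *\<^sub>v w) \<le> real k * (\<zeta> * (U * spec_norm W)) * vnorm w"
    by simp
  moreover have "vnorm (a \<cdot>\<^sub>v (gt - S *\<^sub>v b) + (Ct - S * W) *\<^sub>v w)
      \<le> vnorm (a \<cdot>\<^sub>v (gt - S *\<^sub>v b)) + vnorm ((Ct - S * W) *\<^sub>v w)"
    using vecs gt E w by (intro vnorm_triangle[of _ s]) auto
  ultimately show ?thesis
    unfolding split using g_part by (simp add: algebra_simps)
qed

text \<open>For \<open>a \<noteq> 0\<close> the right-hand side is \<open>\<bar>a\<bar>\<close> times the residual at \<open>- w / a\<close>.\<close>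

lemma minimizer_scaled:
  assumes C: "C \<in> carrier_mat s k" and g: "g \<in> carrier_vec s" and w: "w \<in> carrier_vec k"
    and min: "\<And>z. z \<in> carrier_vec k \<Longrightarrow> vnorm (g - C *\<^sub>v y) \<le> vnorm (g - C *\<^sub>v z)"
  shows "\<bar>a\<bar> * vnorm (g - C *\<^sub>v y) \<le> vnorm (a \<cdot>\<^sub>v g + C *\<^sub>v w)"
proof (cases "a = 0")
  case False
  let ?z = "(- 1 / a) \<cdot>\<^sub>v w"
  have Cz: "C *\<^sub>v ?z = (- 1 / a) \<cdot>\<^sub>v (C *\<^sub>v w)"
    by (rule mult_mat_vec[OF C w])
  have "a \<cdot>\<^sub>v (g - C *\<^sub>v ?z) = a \<cdot>\<^sub>v g + C *\<^sub>v w"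
    unfolding Cz using False C g w by (intro eq_vecI) (auto simp: algebra_simps)
  then have "vnorm (a \<cdot>\<^sub>v g + C *\<^sub>v w) = \<bar>a\<bar> * vnorm (g - C *\<^sub>v ?z)"
    by (metis vnorm_smult)
  then show ?thesis
    using min[of ?z] w by (simp add: mult_left_mono)
qed simp

text \<open>Backward stability of the sketched least squares solution when \<open>[\<phi> b, W]\<close> is numerically rank
  deficient for every \<open>\<phi>\<close> but \<open>W\<close> is not.  A near-null vector \<open>(a, w)\<close> of \<open>[\<phi> b, W]\<close> must then
  have a component \<open>a\<close> of order one, so it exhibits \<open>b\<close> as nearly a combination of the columns of \<open>W\<close>.
  By the embedding the same holds for the perturbed sketch \<open>(gt, Ct)\<close>, where the minimality of \<open>y\<close>
  transfers the small residual to \<open>y\<close>; the lower embedding bound brings it back to the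
  unsketched problem.  For an \<open>\<epsilon>\<close>-embedding, \<open>L\<close> and \<open>U\<close> are the square roots of \<open>1 - \<epsilon>\<close>
  and \<open>1 + \<epsilon>\<close>.

  The near-null vector depends on \<open>\<phi>\<close>, and a bad choice makes the bound for the residual
  useless.  The value \<open>1 / \<phi> = vnorm y + vnorm b / spec_norm W\<close> ensures at once that
  \<open>\<phi> b\<close> is not longer than \<open>spec_norm W\<close> and that \<open>\<phi> y\<close> is not longer than 1, and dividing by it
  produces exactly the quantity \<open>vnorm b + spec_norm W * vnorm y\<close>.\<close>

lemma sketched_least_squares_residual:
  assumes k: "1 \<le> k" and W: "W \<in> carrier_mat n k" and b: "b \<in> carrier_vec n"
    and S: "S \<in> carrier_mat s n"
    and gt: "gt \<in> carrier_vec s" and Ct: "Ct \<in> carrier_mat s k" and y: "y \<in> carrier_vec k"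
    and LU: "0 < L" "L \<le> U" and \<theta>: "0 < \<theta>"
    and lo: "\<And>a w. w \<in> carrier_vec k \<Longrightarrow>
      L * vnorm (a \<cdot>\<^sub>v b + W *\<^sub>v w) \<le> vnorm (S *\<^sub>v (a \<cdot>\<^sub>v b + W *\<^sub>v w))"
    and hi: "\<And>a w. w \<in> carrier_vec k \<Longrightarrow>
      vnorm (S *\<^sub>v (a \<cdot>\<^sub>v b + W *\<^sub>v w)) \<le> U * vnorm (a \<cdot>\<^sub>v b + W *\<^sub>v w)"
    and err_g: "vnorm (gt - S *\<^sub>v b) \<le> 3 * \<theta> * vnorm (S *\<^sub>v b)"
    and err_C: "\<And>j. j < k \<Longrightarrow> vnorm (col (Ct - S * W) j) \<le> 3 * \<theta> * vnorm (S *\<^sub>v col W j)"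
    and min: "\<And>z. z \<in> carrier_vec k \<Longrightarrow> vnorm (gt - Ct *\<^sub>v y) \<le> vnorm (gt - Ct *\<^sub>v z)"
    and near: "\<And>\<phi>. 0 < \<phi> \<Longrightarrow>
      sigma_min (aug (\<phi> \<cdot>\<^sub>v b) W) \<le> \<theta> * spec_norm (aug (\<phi> \<cdot>\<^sub>v b) W)"
    and pos: "0 < sigma_min W"
    and small: "4000 * (U / L) * real k * \<theta> * spec_norm W \<le> sigma_min W"
  shows "vnorm (b - W *\<^sub>v y) \<le> 28 * (U / L) * real k * \<theta> * (vnorm b + spec_norm W * vnorm y)"
proof -
  define N where "N = spec_norm W"
  define T where "T = real k * \<theta> * N"
  have N: "0 < N"
    using pos sigma_min_le_spec_norm[OF W k] by (simp add: N_def)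
  have k1: "1 \<le> real k"
    using k by simp
  have T: "0 < T" "\<theta> * N \<le> T"
    using \<theta> N k1 by (auto simp: T_def)
  have U: "0 < U"
    using LU by simp
  have Wc: "W *\<^sub>v w \<in> carrier_vec n" if "w \<in> carrier_vec k" for w
    using W that by auto
  have b_only: "1 \<cdot>\<^sub>v b + W *\<^sub>v 0\<^sub>v k = b"
    using W b by (intro eq_vecI) auto
  have W_only: "0 \<cdot>\<^sub>v b + W *\<^sub>v w = W *\<^sub>v w" if "w \<in> carrier_vec k" for w
    using W b that by (intro eq_vecI) auto
  have hi_b: "vnorm (S *\<^sub>v b) \<le> U * vnorm b"
    using hi[of "0\<^sub>v k" 1] b_only by simp
  have hi_W: "vnorm (S *\<^sub>v col W j) \<le> U * vnorm (col W j)" if "j < k" for j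
  proof -
    have "W *\<^sub>v unit_vec k j = col W j"
      using W that by (intro eq_vecI) auto
    then show ?thesis
      using hi[of "unit_vec k j" 0] W_only[of "unit_vec k j"] by simp
  qed
  have pert: "vnorm ((a \<cdot>\<^sub>v gt + Ct *\<^sub>v w) - S *\<^sub>v (a \<cdot>\<^sub>v b + W *\<^sub>v w))
      \<le> 3 * \<theta> * U * (\<bar>a\<bar> * vnorm b + real k * N * vnorm w)"
    if "w \<in> carrier_vec k" for a w
    unfolding N_def using \<theta> U
    by (intro sketch_perturbation[OF W b S gt Ct that hi_b hi_W err_g err_C]) auto
  have carr: "a \<cdot>\<^sub>v gt + Ct *\<^sub>v w \<in> carrier_vec s" "S *\<^sub>v (a \<cdot>\<^sub>v b + W *\<^sub>v w) \<in> carrier_vec s"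
    if "w \<in> carrier_vec k" for a w
    using that gt Ct S b Wc by auto
  show ?thesis
  proof (cases "b = 0\<^sub>v n \<and> y = 0\<^sub>v k")
    case True
    then have "b - W *\<^sub>v y = 0\<^sub>v n"
      using W by (intro eq_vecI) auto
    then show ?thesis
      using LU U \<theta> N by (simp add: N_def)
  next
    case False
    define \<psi> where "\<psi> = vnorm y + vnorm b / N"
    have \<psi>: "0 < \<psi>"
    proof -
      have "0 < vnorm y \<or> 0 < vnorm b"
        using False vnorm_eq_0_iff[OF b] vnorm_eq_0_iff[OF y] vnorm_nonneg[of y] vnorm_nonneg[of b]
        by linarith
      then show ?thesis
        using N by (auto simp: \<psi>_def add_pos_nonneg add_nonneg_pos)
    qed
    define \<phi> where "\<phi> = 1 / \<psi>"
    have \<phi>: "0 < \<phi>"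
      using \<psi> by (simp add: \<phi>_def)
    have \<phi>b: "\<phi> * vnorm b \<le> N" and \<phi>y: "\<phi> * vnorm y \<le> 1"
    proof -
      have "vnorm b \<le> N * \<psi>"
        using N by (simp add: \<psi>_def algebra_simps)
      then show "\<phi> * vnorm b \<le> N"
        using \<psi> by (simp add: \<phi>_def field_simps)
      have "vnorm y \<le> \<psi>"
        using N by (simp add: \<psi>_def)
      then show "\<phi> * vnorm y \<le> 1"
        using \<psi> by (simp add: \<phi>_def field_simps)
    qed
    have aug: "aug (\<phi> \<cdot>\<^sub>v b) W \<in> carrier_mat n (Suc k)"
      using aug_carrier[of "\<phi> \<cdot>\<^sub>v b" n W k] b W by simp
    have aug_mult: "aug (\<phi> \<cdot>\<^sub>v b) W *\<^sub>v vCons a w = (a * \<phi>) \<cdot>\<^sub>v b + W *\<^sub>v w"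
      if "w \<in> carrier_vec k" for a w
      using aug_mult_vCons[of "\<phi> \<cdot>\<^sub>v b" n W k w a] that b W by (simp add: smult_smult_assoc)
    have unit_split: "\<bar>a\<bar> \<le> 1 \<and> vnorm w \<le> 1 \<and> 1 \<le> \<bar>a\<bar> + vnorm w"
      if "vnorm (vCons a w) = 1" for a w
    proof -
      have sq: "1 = \<bar>a\<bar>\<^sup>2 + (vnorm w)\<^sup>2"
        using vnorm_vCons[of a w] that by simp
      have "\<bar>a\<bar>\<^sup>2 \<le> 1\<^sup>2" "(vnorm w)\<^sup>2 \<le> 1\<^sup>2"
        unfolding one_power2
        using sq zero_le_power2[of "\<bar>a\<bar>"] zero_le_power2[of "vnorm w"] by linarith+
      then have "\<bar>a\<bar> \<le> 1 \<and> vnorm w \<le> 1"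
        using power2_le_imp_le[of "\<bar>a\<bar>" 1] power2_le_imp_le[of "vnorm w" 1] by simp
      moreover have "1\<^sup>2 \<le> (\<bar>a\<bar> + vnorm w)\<^sup>2"
        using sq by (simp add: power2_sum)
      then have "1 \<le> \<bar>a\<bar> + vnorm w"
        by (rule power2_le_imp_le) simp
      ultimately show ?thesis by blast
    qed
    have vec_split: "\<exists>a w. v = vCons a w \<and> w \<in> carrier_vec k" if "v \<in> carrier_vec (Suc k)" for v :: "real vec"
      using that by (cases v) (auto simp: zero_vec_Suc)
    have "spec_norm (aug (\<phi> \<cdot>\<^sub>v b) W) \<le> \<phi> * vnorm b + N"
    proof (rule spec_norm_le[OF aug])
      fix v :: "real vec" assume v: "v \<in> carrier_vec (Suc k)" "vnorm v = 1"
      then obtain a w where aw: "v = vCons a w" and w: "w \<in> carrier_vec k"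
        using vec_split by blast
      have "vnorm (aug (\<phi> \<cdot>\<^sub>v b) W *\<^sub>v v) \<le> vnorm ((a * \<phi>) \<cdot>\<^sub>v b) + vnorm (W *\<^sub>v w)"
        unfolding aw aug_mult[OF w] using b Wc[OF w] by (intro vnorm_triangle[of _ n]) auto
      also have "\<dots> \<le> \<bar>a\<bar> * (\<phi> * vnorm b) + N * vnorm w"
        using vnorm_mult_mat_vec_le_spec[OF W w] \<phi> by (simp add: vnorm_smult abs_mult N_def)
      also have "\<dots> \<le> \<phi> * vnorm b + N"
        using unit_split[of a w] v(2) aw \<phi> N
        by (intro add_mono mult_left_le_one_le mult_left_le) auto
      finally show "vnorm (aug (\<phi> \<cdot>\<^sub>v b) W *\<^sub>v v) \<le> \<phi> * vnorm b + N" .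
    qed simp
    then have "\<theta> * spec_norm (aug (\<phi> \<cdot>\<^sub>v b) W) \<le> \<theta> * (2 * N)"
      using \<phi>b \<theta> by (intro mult_left_mono) auto
    then have near_\<phi>: "sigma_min (aug (\<phi> \<cdot>\<^sub>v b) W) < 4 * \<theta> * N"
      using near[OF \<phi>] mult_pos_pos[OF \<theta> N] by linarith
    obtain v where v: "v \<in> carrier_vec (Suc k)" "vnorm v = 1"
        "vnorm (aug (\<phi> \<cdot>\<^sub>v b) W *\<^sub>v v) < 4 * \<theta> * N"
      by (rule sigma_min_less_obtain[OF aug _ near_\<phi>]) simp
    obtain a w where aw: "v = vCons a w" and w: "w \<in> carrier_vec k"
      using vec_split v(1) by blast
    have unit: "\<bar>a\<bar> \<le> 1" "vnorm w \<le> 1" "1 \<le> \<bar>a\<bar> + vnorm w"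
      using unit_split[of a w] v(2) aw by auto
    define h where "h = vnorm ((a * \<phi>) \<cdot>\<^sub>v gt + Ct *\<^sub>v w)"
    define \<rho> where "\<rho> = vnorm (gt - Ct *\<^sub>v y)"
    \<comment> \<open>The near-null vector of \<open>[\<phi> b, W]\<close> is also one of the perturbed sketch.\<close>
    have h: "h \<le> 10 * U * T"
    proof -
      have "h \<le> vnorm (S *\<^sub>v ((a * \<phi>) \<cdot>\<^sub>v b + W *\<^sub>v w))
          + 3 * \<theta> * U * (\<bar>a * \<phi>\<bar> * vnorm b + real k * N * vnorm w)"
        unfolding h_def using vnorm_le_diff[OF carr[OF w]] pert[OF w] by (meson add_left_mono order_trans)
      also have "\<dots> \<le> U * (4 * \<theta> * N) + 3 * \<theta> * U * (N + real k * N)"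
      proof (intro add_mono mult_left_mono)
        show "vnorm (S *\<^sub>v ((a * \<phi>) \<cdot>\<^sub>v b + W *\<^sub>v w)) \<le> U * (4 * \<theta> * N)"
          using hi[OF w, of "a * \<phi>"] v(3) U unfolding aw aug_mult[OF w]
          by (meson less_imp_le mult_left_mono order_trans)
        have "\<bar>a\<bar> * (\<phi> * vnorm b) \<le> 1 * N"
          using unit \<phi>b \<phi> by (intro mult_mono) auto
        then show "\<bar>a * \<phi>\<bar> * vnorm b \<le> N"
          using \<phi> by (simp add: abs_mult)
        show "real k * N * vnorm w \<le> real k * N"
          using unit N by (intro mult_left_le) auto
      qed (use \<theta> U in auto)
      also have "\<dots> = U * (7 * (\<theta> * N) + 3 * T)"
        by (simp add: T_def algebra_simps)
      also have "\<dots> \<le> U * (10 * T)"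
        using T U by (intro mult_left_mono) auto
      finally show ?thesis by simp
    qed
    have a\<rho>: "\<bar>a\<bar> * \<phi> * \<rho> \<le> h"
      using minimizer_scaled[OF Ct gt w min, of "a * \<phi>"] \<phi> by (simp add: h_def \<rho>_def abs_mult)
    \<comment> \<open>If \<open>y\<close> were an exact solution, the null vectors would be the multiples of \<open>(1 / \<phi>, - y)\<close>;
      \<open>z\<close> measures the deviation from this.  It is small because \<open>Ct z\<close> is a difference of two
      short vectors and \<open>W\<close>, hence \<open>Ct\<close>, is well conditioned.\<close>
    define z where "z = w + (a * \<phi>) \<cdot>\<^sub>v y"
    have z: "z \<in> carrier_vec k"
      using w y by (simp add: z_def)
    have "vnorm (Ct *\<^sub>v z) \<le> 2 * h"
    proof -
      have "Ct *\<^sub>v z = Ct *\<^sub>v w + (a * \<phi>) \<cdot>\<^sub>v (Ct *\<^sub>v y)"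
        using Ct w y by (simp add: z_def mult_add_distrib_mat_vec mult_mat_vec)
      also have "\<dots> = ((a * \<phi>) \<cdot>\<^sub>v gt + Ct *\<^sub>v w) - (a * \<phi>) \<cdot>\<^sub>v (gt - Ct *\<^sub>v y)"
        using Ct gt w y by (intro eq_vecI) (auto simp: algebra_simps)
      finally have "vnorm (Ct *\<^sub>v z) \<le> h + vnorm ((a * \<phi>) \<cdot>\<^sub>v (gt - Ct *\<^sub>v y))"
        unfolding h_def using Ct gt w y by (simp add: vnorm_triangle_diff[of _ s])
      then show ?thesis
        using a\<rho> \<phi> by (simp add: vnorm_smult abs_mult \<rho>_def)
    qed
    moreover have "L * (sigma_min W * vnorm z) \<le> vnorm (Ct *\<^sub>v z) + 3 * \<theta> * U * (real k * N * vnorm z)"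
    proof -
      have "L * (sigma_min W * vnorm z) \<le> L * vnorm (W *\<^sub>v z)"
        using sigma_min_le_vnorm_mult_mat_vec[OF W z] LU by (intro mult_left_mono) auto
      also have "\<dots> \<le> vnorm (S *\<^sub>v (W *\<^sub>v z))"
        using lo[OF z, of 0] W_only[OF z] by simp
      also have "\<dots> \<le> vnorm (Ct *\<^sub>v z) + vnorm (S *\<^sub>v (W *\<^sub>v z) - Ct *\<^sub>v z)"
        using S W Ct z by (intro vnorm_le_diff[of _ s]) auto
      also have "vnorm (S *\<^sub>v (W *\<^sub>v z) - Ct *\<^sub>v z) = vnorm (Ct *\<^sub>v z - S *\<^sub>v (W *\<^sub>v z))"
        using S W Ct z by (intro vnorm_minus_commute[of _ s]) auto
      also have "\<dots> \<le> 3 * \<theta> * U * (real k * N * vnorm z)"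
      proof -
        have "0 \<cdot>\<^sub>v gt + Ct *\<^sub>v z = Ct *\<^sub>v z"
          using gt Ct z by (intro eq_vecI) auto
        then show ?thesis
          using pert[OF z, of 0] W_only[OF z] by simp
      qed
      finally show ?thesis by simp
    qed
    ultimately have "L * (sigma_min W * vnorm z) \<le> U * T * (20 + 3 * vnorm z)"
      using h by (simp add: T_def algebra_simps)
    then have "sigma_min W * vnorm z \<le> (U / L) * T * (20 + 3 * vnorm z)"
      using LU by (simp add: field_simps)
    also have "\<dots> \<le> (sigma_min W / 4000) * (20 + 3 * vnorm z)"
      using small by (intro mult_right_mono) (auto simp: T_def N_def ac_simps)
    also have "\<dots> = sigma_min W * ((20 + 3 * vnorm z) / 4000)"
      by simp
    finally have "vnorm z \<le> (20 + 3 * vnorm z) / 4000"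
      using pos by (rule mult_left_le_imp_le)
    then have z_small: "vnorm z \<le> 1 / 100"
      by simp
    have "vnorm w \<le> vnorm z + \<bar>a\<bar>"
    proof -
      have "w = z - (a * \<phi>) \<cdot>\<^sub>v y"
        using w y by (intro eq_vecI) (auto simp: z_def)
      then have "vnorm w \<le> vnorm z + \<bar>a\<bar> * (\<phi> * vnorm y)"
        using vnorm_triangle_diff[of z k "(a * \<phi>) \<cdot>\<^sub>v y"] z y \<phi> by (simp add: vnorm_smult abs_mult)
      moreover have "\<bar>a\<bar> * (\<phi> * vnorm y) \<le> \<bar>a\<bar>"
        using \<phi>y \<phi> by (intro mult_left_le) auto
      ultimately show ?thesis by linarith
    qed
    then have a_large: "2 / 5 \<le> \<bar>a\<bar>"
      using unit z_small by linarith
    have "2 / 5 * (\<phi> * \<rho>) \<le> \<bar>a\<bar> * (\<phi> * \<rho>)"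
      using a_large \<phi> by (intro mult_right_mono) (auto simp: \<rho>_def)
    then have "\<phi> * \<rho> \<le> 25 * U * T"
      using a\<rho> h by linarith
    then have "\<rho> \<le> 25 * U * T * \<psi>"
      using \<psi> by (simp add: \<phi>_def field_simps)
    also have "\<dots> = 25 * U * (real k * \<theta>) * (N * \<psi>)"
      by (simp add: T_def)
    also have "N * \<psi> = vnorm b + N * vnorm y"
      using N by (simp add: \<psi>_def field_simps)
    finally have \<rho>: "\<rho> \<le> 25 * U * (real k * \<theta>) * (vnorm b + N * vnorm y)" .
    have diff: "b - W *\<^sub>v y = 1 \<cdot>\<^sub>v b + W *\<^sub>v (- y)"
      using b W y by (intro eq_vecI) auto
    have y': "- y \<in> carrier_vec k"
      using y by simp
    have gdiff: "gt + Ct *\<^sub>v (- y) = gt - Ct *\<^sub>v y"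
      using gt Ct y by (intro eq_vecI) auto
    have "L * vnorm (b - W *\<^sub>v y) \<le> vnorm (S *\<^sub>v (1 \<cdot>\<^sub>v b + W *\<^sub>v (- y)))"
      unfolding diff by (rule lo[OF y'])
    also have "\<dots> \<le> \<rho> + 3 * \<theta> * U * (vnorm b + real k * N * vnorm y)"
      using vnorm_le_diff[OF carr(2)[OF y'] carr(1)[OF y'], of 1 1]
        vnorm_minus_commute[OF carr(2)[OF y'] carr(1)[OF y'], of 1 1] pert[OF y', of 1]
      by (simp add: gdiff \<rho>_def)
    also have "\<dots> \<le> \<rho> + 3 * \<theta> * U * (real k * vnorm b + real k * N * vnorm y)"
      using \<theta> U mult_right_mono[OF k1 vnorm_nonneg[of b]]
      by (intro add_left_mono mult_left_mono add_right_mono) auto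
    also have "\<dots> \<le> 28 * U * (real k * \<theta>) * (vnorm b + N * vnorm y)"
      using \<rho> by (simp add: algebra_simps)
    finally show ?thesis
      using LU by (simp add: N_def field_simps)
  qed
qed

section \<open>The residual of one refinement step\<close>

text \<open>The condition number is defined through \<open>sigma_min\<close>, but preconditioning by \<open>M\<close> produces the
  norms of \<open>M\<close> and its inverse; the second part shows that their product is at most
  the condition number.\<close>

lemma spec_norm_right_inverse:
  assumes M: "M \<in> carrier_mat n n" and N: "N \<in> carrier_mat n n" and MN: "M * N = 1\<^sub>m n"
    and n: "1 \<le> n"
  shows "1 \<le> spec_norm M * spec_norm N" and "sigma_min M * spec_norm N \<le> 1"
proof -
  have inv: "M *\<^sub>v (N *\<^sub>v v) = v" if "v \<in> carrier_vec n" for v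
    using assoc_mult_mat_vec[OF M N that] MN that by simp
  obtain v where v: "v \<in> carrier_vec n" "vnorm v = 1"
    using unit_vecs_nonempty[OF n] unfolding unit_vecs_def by blast
  have "1 \<le> spec_norm M * vnorm (N *\<^sub>v v)"
    using vnorm_mult_mat_vec_le_spec[OF M, of "N *\<^sub>v v"] N v inv by simp
  also have "\<dots> \<le> spec_norm M * spec_norm N"
    using vnorm_mult_mat_vec_le_spec[OF N v(1)] v(2) spec_norm_nonneg[OF M n]
    by (simp add: mult_left_mono)
  finally show "1 \<le> spec_norm M * spec_norm N" .
  show "sigma_min M * spec_norm N \<le> 1"
  proof (cases "sigma_min M = 0")
    case False
    then have pos: "0 < sigma_min M"
      using sigma_min_nonneg[OF M n] by simp
    have "spec_norm N \<le> 1 / sigma_min M"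
    proof (rule spec_norm_le[OF N n])
      fix w assume "w \<in> carrier_vec n" "vnorm w = 1"
      then show "vnorm (N *\<^sub>v w) \<le> 1 / sigma_min M"
        using sigma_min_le_vnorm_mult_mat_vec[OF M, of "N *\<^sub>v w"] N inv pos
        by (simp add: field_simps)
    qed
    then show ?thesis
      using pos by (simp add: field_simps)
  qed simp
qed

text \<open>The identity \<open>M ((b - W y) - \<Delta>b + \<Delta>W y) = r - A Z y\<close> removes the left preconditioner \<open>M\<close>
  (with inverse \<open>N\<close>).  All three terms are bounded by a small multiple of the norm of \<open>N\<close> times
  \<open>vnorm r + spec_norm Z * fro_norm A * vnorm y\<close>, which makes the product of the norms of \<open>M\<close>
  and \<open>N\<close> appear.\<close>

lemma correction_residual:
  assumes n: "1 \<le> n" and k: "1 \<le> k"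
    and A: "A \<in> carrier_mat n n"
    and M: "M \<in> carrier_mat n n" and N: "N \<in> carrier_mat n n" and MN: "M * N = 1\<^sub>m n"
    and r: "r \<in> carrier_vec n" and Z: "Z \<in> carrier_mat n k" and y: "y \<in> carrier_vec k"
    and \<Delta>W: "\<Delta>W \<in> carrier_mat n k"
      "fro_norm \<Delta>W \<le> \<theta> * spec_norm N * fro_norm A * fro_norm Z"
    and \<Delta>b: "\<Delta>b \<in> carrier_vec n" "vnorm \<Delta>b \<le> \<theta> * spec_norm N * vnorm r"
    and \<Delta>d: "\<Delta>d \<in> carrier_vec n" "vnorm \<Delta>d \<le> \<theta> * spec_norm Z * vnorm y"
    and W: "W = N * A * Z + \<Delta>W" and b: "b = N *\<^sub>v r + \<Delta>b" and d: "d = Z *\<^sub>v y + \<Delta>d"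
    and \<theta>: "0 \<le> \<theta>" "real k * \<theta> \<le> 1" and c: "28 * real k * \<theta> \<le> c"
    and ls: "vnorm (b - W *\<^sub>v y) \<le> c * (vnorm b + spec_norm W * vnorm y)"
  shows "vnorm (r - A *\<^sub>v d)
    \<le> 3 * c * (spec_norm M * spec_norm N) * (vnorm r + spec_norm Z * fro_norm A * vnorm y)"
proof -
  define E where "E = spec_norm Z * fro_norm A * vnorm y"
  define \<nu> where "\<nu> = spec_norm N"
  define \<kappa> where "\<kappa> = spec_norm M * spec_norm N"
  have \<nu>: "0 \<le> \<nu>" and M0: "0 \<le> spec_norm M" and Z0: "0 \<le> spec_norm Z"
    using spec_norm_nonneg[OF N n] spec_norm_nonneg[OF M n] spec_norm_nonneg[OF Z k]
    by (auto simp: \<nu>_def)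
  have E: "0 \<le> E"
    using Z0 by (simp add: E_def)
  have c0: "0 \<le> c"
  proof -
    have "0 \<le> real k * \<theta>" using \<theta> by simp
    then show ?thesis using c by linarith
  qed
  have \<theta>k: "\<theta> \<le> real k * \<theta>"
    using \<theta> k by (simp add: mult_le_cancel_right1)
  have \<theta>1: "\<theta> \<le> 1"
    using \<theta>k \<theta> by linarith
  have NAZ: "N * A * Z \<in> carrier_mat n k"
    using N A Z by auto
  have Wc: "W \<in> carrier_mat n k"
    unfolding W using NAZ \<Delta>W by auto
  have spec_\<Delta>W: "spec_norm \<Delta>W \<le> real k * \<theta> * \<nu> * (fro_norm A * spec_norm Z)"
  proof -
    have "\<theta> * spec_norm N * fro_norm A * fro_norm Z
        \<le> \<theta> * spec_norm N * fro_norm A * (real k * spec_norm Z)"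
      using fro_norm_le_spec_norm[OF Z] \<theta> \<nu> by (intro mult_left_mono) (auto simp: \<nu>_def)
    then show ?thesis
      using spec_norm_le_fro_norm[OF \<Delta>W(1) k] \<Delta>W(2) by (simp add: \<nu>_def algebra_simps)
  qed
  have W_mult: "W *\<^sub>v v = N *\<^sub>v (A *\<^sub>v (Z *\<^sub>v v)) + \<Delta>W *\<^sub>v v" if v: "v \<in> carrier_vec k" for v
  proof -
    have "W *\<^sub>v v = (N * A * Z) *\<^sub>v v + \<Delta>W *\<^sub>v v"
      unfolding W by (rule add_mult_distrib_mat_vec[OF NAZ \<Delta>W(1) v])
    also have "(N * A * Z) *\<^sub>v v = N *\<^sub>v (A *\<^sub>v (Z *\<^sub>v v))"
      using assoc_mult_mat_vec[OF mult_carrier_mat[OF N A] Z v]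
        assoc_mult_mat_vec[OF N A mult_mat_vec_carrier[OF Z v]] by simp
    finally show ?thesis .
  qed
  have spec_W: "spec_norm W \<le> 2 * \<nu> * (fro_norm A * spec_norm Z)"
  proof (rule spec_norm_le[OF Wc k])
    fix v assume v: "v \<in> carrier_vec k" "vnorm v = 1"
    have "W *\<^sub>v v = N *\<^sub>v (A *\<^sub>v (Z *\<^sub>v v)) + \<Delta>W *\<^sub>v v"
      by (rule W_mult[OF v(1)])
    then have "vnorm (W *\<^sub>v v) \<le> vnorm (N *\<^sub>v (A *\<^sub>v (Z *\<^sub>v v))) + vnorm (\<Delta>W *\<^sub>v v)"
      using N A Z \<Delta>W v by (simp add: vnorm_triangle[of _ n])
    also have "vnorm (N *\<^sub>v (A *\<^sub>v (Z *\<^sub>v v))) \<le> \<nu> * (fro_norm A * (spec_norm Z * 1))"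
      unfolding \<nu>_def v(2)[symmetric] using N A Z v \<nu>
      by (intro order_trans[OF vnorm_mult_mat_vec_le_spec[of _ n n]] mult_left_mono
          order_trans[OF vnorm_mult_mat_vec_le_fro[of _ n n]] vnorm_mult_mat_vec_le_spec[of _ n k])
        (auto simp: \<nu>_def)
    also have "vnorm (\<Delta>W *\<^sub>v v) \<le> real k * \<theta> * (\<nu> * (fro_norm A * spec_norm Z))"
      using vnorm_mult_mat_vec_le_spec[OF \<Delta>W(1) v(1)] v(2) spec_\<Delta>W by (simp add: mult.assoc)
    also have "\<dots> \<le> 1 * (\<nu> * (fro_norm A * spec_norm Z))"
      using \<theta> \<nu> Z0 by (intro mult_right_mono) auto
    finally show "vnorm (W *\<^sub>v v) \<le> 2 * \<nu> * (fro_norm A * spec_norm Z)"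
      by simp
  qed
  have vnorm_b: "vnorm b \<le> 2 * \<nu> * vnorm r"
  proof -
    have "vnorm b \<le> \<nu> * vnorm r + \<theta> * (\<nu> * vnorm r)"
      unfolding b using vnorm_triangle[of "N *\<^sub>v r" n \<Delta>b] vnorm_mult_mat_vec_le_spec[OF N r] N r \<Delta>b
      by (simp add: \<nu>_def algebra_simps)
    moreover have "\<theta> * (\<nu> * vnorm r) \<le> 1 * (\<nu> * vnorm r)"
      using \<theta>1 \<nu> by (intro mult_right_mono) auto
    ultimately show ?thesis by simp
  qed
  have ls': "vnorm (b - W *\<^sub>v y) \<le> 2 * c * \<nu> * (vnorm r + E)"
  proof -
    have "spec_norm W * vnorm y \<le> 2 * \<nu> * E"
      using mult_right_mono[OF spec_W vnorm_nonneg[of y]] by (simp add: E_def algebra_simps)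
    then have "c * (vnorm b + spec_norm W * vnorm y) \<le> c * (2 * \<nu> * vnorm r + 2 * \<nu> * E)"
      using vnorm_b c0 by (intro mult_left_mono) auto
    then show ?thesis
      using ls by (simp add: algebra_simps)
  qed
  have Wy: "W *\<^sub>v y = N *\<^sub>v (A *\<^sub>v (Z *\<^sub>v y)) + \<Delta>W *\<^sub>v y"
    by (rule W_mult[OF y])
  define f where "f = (b - W *\<^sub>v y) - \<Delta>b + \<Delta>W *\<^sub>v y"
  have \<Delta>Wy: "\<Delta>W *\<^sub>v y \<in> carrier_vec n" and Wy_carr: "W *\<^sub>v y \<in> carrier_vec n"
    using mult_mat_vec_carrier[OF \<Delta>W(1) y] mult_mat_vec_carrier[OF Wc y] .
  have b_carr: "b \<in> carrier_vec n"
    using mult_mat_vec_carrier[OF N r] \<Delta>b(1) by (simp add: b)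
  have bW: "b - W *\<^sub>v y \<in> carrier_vec n"
    using b_carr Wy_carr by simp
  have f_carr: "f \<in> carrier_vec n"
    using bW \<Delta>b(1) \<Delta>Wy by (simp add: f_def)
  have f_eq: "f = N *\<^sub>v r - N *\<^sub>v (A *\<^sub>v (Z *\<^sub>v y))"
    unfolding f_def Wy b using N \<Delta>b \<Delta>W by (intro eq_vecI) auto
  have Mf: "M *\<^sub>v f = r - A *\<^sub>v (Z *\<^sub>v y)"
  proof -
    have carr: "A *\<^sub>v (Z *\<^sub>v y) \<in> carrier_vec n"
      using A Z y by auto
    have "f = N *\<^sub>v (r - A *\<^sub>v (Z *\<^sub>v y))"
      unfolding f_eq using mult_minus_distrib_mat_vec[OF N r carr] by simp
    then show ?thesis
      using assoc_mult_mat_vec[OF M N, of "r - A *\<^sub>v (Z *\<^sub>v y)"] MN r carr by simp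
  qed
  have "vnorm f \<le> vnorm (b - W *\<^sub>v y) + vnorm \<Delta>b + vnorm (\<Delta>W *\<^sub>v y)"
    unfolding f_def
    using vnorm_triangle[of "(b - W *\<^sub>v y) - \<Delta>b" n "\<Delta>W *\<^sub>v y"] vnorm_triangle_diff[OF bW \<Delta>b(1)] bW \<Delta>b \<Delta>Wy
    by simp
  also have "\<dots> \<le> 2 * c * \<nu> * (vnorm r + E) + real k * \<theta> * \<nu> * vnorm r + real k * \<theta> * \<nu> * E"
  proof (intro add_mono ls')
    have "\<theta> * (\<nu> * vnorm r) \<le> real k * \<theta> * (\<nu> * vnorm r)"
      using \<theta>k \<nu> by (intro mult_right_mono) auto
    then show "vnorm \<Delta>b \<le> real k * \<theta> * \<nu> * vnorm r"
      using \<Delta>b(2) by (simp add: \<nu>_def mult.assoc)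
    show "vnorm (\<Delta>W *\<^sub>v y) \<le> real k * \<theta> * \<nu> * E"
      using vnorm_mult_mat_vec_le_spec[OF \<Delta>W(1) y] mult_right_mono[OF spec_\<Delta>W vnorm_nonneg[of y]]
      by (simp add: E_def algebra_simps)
  qed
  also have "\<dots> = (2 * c + real k * \<theta>) * (\<nu> * (vnorm r + E))"
    by (simp add: algebra_simps)
  also have "\<dots> \<le> (2 * c + c / 28) * (\<nu> * (vnorm r + E))"
    using c \<nu> E by (intro mult_right_mono) auto
  finally have "vnorm (M *\<^sub>v f) \<le> spec_norm M * ((2 * c + c / 28) * (\<nu> * (vnorm r + E)))"
    using vnorm_mult_mat_vec_le_spec[OF M f_carr] M0 by (meson mult_left_mono order_trans)
  then have Mf_bound: "vnorm (M *\<^sub>v f) \<le> (2 * c + c / 28) * (\<kappa> * (vnorm r + E))"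
    by (simp add: \<kappa>_def \<nu>_def algebra_simps)
  have "vnorm (A *\<^sub>v \<Delta>d) \<le> fro_norm A * (\<theta> * spec_norm Z * vnorm y)"
    using vnorm_mult_mat_vec_le_fro[OF A \<Delta>d(1)] mult_left_mono[OF \<Delta>d(2) fro_norm_nonneg[of A]]
    by linarith
  then have A\<Delta>d: "vnorm (A *\<^sub>v \<Delta>d) \<le> \<theta> * E"
    by (simp add: E_def algebra_simps)
  have "\<theta> * E \<le> (c / 28) * (\<kappa> * (vnorm r + E))"
  proof (rule mult_mono)
    have "1 * (vnorm r + E) \<le> \<kappa> * (vnorm r + E)"
      using spec_norm_right_inverse(1)[OF M N MN n] E by (intro mult_right_mono) (auto simp: \<kappa>_def)
    then show "E \<le> \<kappa> * (vnorm r + E)"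
      by (rule order_trans[rotated]) simp
  qed (use \<theta>k c c0 E in auto)
  moreover have "r - A *\<^sub>v d = M *\<^sub>v f - A *\<^sub>v \<Delta>d"
    unfolding Mf d using A Z y r \<Delta>d
    by (subst mult_add_distrib_mat_vec[OF A]) (auto intro!: eq_vecI)
  then have "vnorm (r - A *\<^sub>v d) \<le> vnorm (M *\<^sub>v f) + vnorm (A *\<^sub>v \<Delta>d)"
    using M A f_carr \<Delta>d by (simp add: vnorm_triangle_diff[of _ n])
  ultimately have "vnorm (r - A *\<^sub>v d) \<le> (2 * c + c / 28) * (\<kappa> * (vnorm r + E)) + (c / 28) * (\<kappa> * (vnorm r + E))"
    using Mf_bound A\<Delta>d by linarith
  also have "\<dots> = (2 * c + c / 28 + c / 28) * (\<kappa> * (vnorm r + E))"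
    by (rule distrib_right[symmetric])
  also have "\<dots> \<le> 3 * c * (\<kappa> * (vnorm r + E))"
    using c0 E M0 \<nu> by (intro mult_right_mono) (auto simp: \<kappa>_def \<nu>_def)
  finally show ?thesis
    by (simp add: E_def \<kappa>_def mult.assoc)
qed

text \<open>The quantity \<open>E\<close> is proportional to \<open>vnorm (A d)\<close>, and \<open>A d\<close> differs from \<open>r\<close> by the very
  residual that is to be bounded; as \<open>\<beta> (1 + \<tau>)\<close> is small, this residual can be absorbed into
  the left-hand side.\<close>

lemma correction_residual_relative:
  assumes A: "A \<in> carrier_mat n n" and r: "r \<in> carrier_vec n" and d: "d \<in> carrier_vec n"
    and bound: "vnorm (r - A *\<^sub>v d) \<le> \<beta> * (vnorm r + E)" and E: "E = \<tau> * vnorm (A *\<^sub>v d)"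
    and \<tau>: "0 \<le> \<tau>" and \<beta>: "0 \<le> \<beta>" and \<mu>: "\<beta> * (1 + \<tau>) \<le> 1 / 80"
  shows "vnorm (r - A *\<^sub>v d) \<le> 2 * (\<beta> * (1 + \<tau>)) * vnorm r"
    and "2 * (\<beta> * E) \<le> 4 * (\<beta> * (1 + \<tau>)) * vnorm r"
proof -
  define \<mu>' where "\<mu>' = \<beta> * (1 + \<tau>)"
  define f where "f = vnorm (r - A *\<^sub>v d)"
  have Ad: "A *\<^sub>v d \<in> carrier_vec n"
    using A d by auto
  have f0: "0 \<le> f"
    by (simp add: f_def)
  have "vnorm (A *\<^sub>v d) \<le> vnorm r + f"
    unfolding f_def using vnorm_le_diff[OF Ad r] vnorm_minus_commute[OF Ad r] by simp
  then have "(\<beta> * \<tau>) * vnorm (A *\<^sub>v d) \<le> (\<beta> * \<tau>) * (vnorm r + f)"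
    using \<beta> \<tau> by (intro mult_left_mono) auto
  then have \<beta>E: "\<beta> * E \<le> \<beta> * \<tau> * vnorm r + \<beta> * \<tau> * f"
    by (simp add: E algebra_simps)
  have "\<beta> * \<tau> * f \<le> 1 / 80 * f"
    using \<mu> \<beta> f0 by (intro mult_right_mono) (auto simp: algebra_simps)
  moreover have "f \<le> \<beta> * vnorm r + \<beta> * E"
    using bound by (simp add: f_def algebra_simps)
  moreover have "\<mu>' * vnorm r = \<beta> * vnorm r + \<beta> * \<tau> * vnorm r"
    by (simp add: \<mu>'_def algebra_simps)
  moreover have "0 \<le> \<beta> * vnorm r"
    using \<beta> by simp
  moreover have "0 \<le> \<beta> * \<tau> * vnorm r"
    using \<beta> \<tau> by simp
  ultimately have f: "f \<le> 2 * (\<mu>' * vnorm r)" and "2 * (\<beta> * E) \<le> 4 * (\<mu>' * vnorm r)"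
    using \<beta>E by linarith+
  then show "vnorm (r - A *\<^sub>v d) \<le> 2 * (\<beta> * (1 + \<tau>)) * vnorm r"
    and "2 * (\<beta> * E) \<le> 4 * (\<beta> * (1 + \<tau>)) * vnorm r"
    by (simp_all add: f_def \<mu>'_def)
qed

text \<open>The error of the computed residual is relative to the scale of the old iterate \<open>x\<close>, which may be
  much larger than that of \<open>x'\<close>.  It can exceed it only through the correction, since
  \<open>x = (x + d) - d\<close>, and by the last assumption \<open>\<theta>\<close> times the contribution of the correction is a
  small multiple of the norm of the computed residual.  Hence the old scale can be traded for the new
  one and a multiple of the old residual.\<close>

lemma refined_residual:
  assumes A: "A \<in> carrier_mat n n" and b: "b \<in> carrier_vec n"
    and x: "x \<in> carrier_vec n" and x': "x' \<in> carrier_vec n"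
    and r: "r_hat c \<in> carrier_vec n" and d: "d_hat c \<in> carrier_vec n"
    and step: "refinement_step \<theta> A b x c x'"
    and \<theta>: "0 \<le> \<theta>" "\<theta> \<le> 1 / 2" and \<mu>: "0 \<le> \<mu>" "\<mu> \<le> 1 / 80"
    and corr: "vnorm (r_hat c - A *\<^sub>v d_hat c) \<le> 2 * \<mu> * vnorm (r_hat c)"
    and d_small: "\<theta> * (fro_norm A * vnorm (d_hat c)) \<le> 4 * \<mu> * vnorm (r_hat c)"
  shows "vnorm (residual A b x') \<le> 18 * \<mu> * vnorm (residual A b x) + 10 * \<theta> * residual_scale A b x'"
proof -
  define q where "q = r_hat c"
  define e where "e = d_hat c"
  define w where "w = x + e"
  define \<alpha> where "\<alpha> = fro_norm A"
  note defs = q_def[symmetric] e_def[symmetric] w_def[symmetric] \<alpha>_def[symmetric]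
  have carr: "q \<in> carrier_vec n" "e \<in> carrier_vec n" "w \<in> carrier_vec n"
    using r d x by (auto simp: q_def e_def w_def)
  have res: "residual A b x \<in> carrier_vec n"
    using A b x by (auto simp: residual_def)
  have \<alpha>0: "0 \<le> \<alpha>" by (simp add: \<alpha>_def)
  have s1: "vnorm (q - residual A b x) \<le> \<theta> * residual_scale A b x"
    and s2: "vnorm (x' - w) \<le> \<theta> * vnorm w"
    using step by (auto simp: refinement_step_def residual_scale_def defs add.commute)
  have "vnorm w \<le> vnorm x' + \<theta> * vnorm w"
    using vnorm_le_diff[OF carr(3) x'] vnorm_minus_commute[OF carr(3) x'] s2 by simp
  moreover have "\<theta> * vnorm w \<le> 1 / 2 * vnorm w"
    using \<theta> by (intro mult_right_mono) auto
  ultimately have w: "vnorm w \<le> 2 * vnorm x'"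
    by simp
  have \<alpha>w: "\<theta> * (\<alpha> * vnorm w) \<le> 2 * (\<theta> * (\<alpha> * vnorm x'))"
    using mult_left_mono[OF mult_left_mono[OF w \<alpha>0] \<theta>(1)] by simp
  have "x = w - e"
    using x carr by (intro eq_vecI) (auto simp: w_def)
  then have "vnorm x \<le> vnorm w + vnorm e"
    using vnorm_triangle_diff[OF carr(3,2)] by simp
  then have "\<theta> * (\<alpha> * vnorm x) \<le> \<theta> * (\<alpha> * vnorm w) + \<theta> * (\<alpha> * vnorm e)"
    using \<theta> \<alpha>0 by (metis distrib_left mult_left_mono)
  then have scale: "\<theta> * residual_scale A b x \<le> 2 * (\<theta> * residual_scale A b x') + 4 * \<mu> * vnorm q"
    using d_small \<alpha>w mult_nonneg_nonneg[OF \<theta>(1) vnorm_nonneg[of b]]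
    by (simp add: residual_scale_def defs algebra_simps)
  have "vnorm q \<le> vnorm (residual A b x) + \<theta> * residual_scale A b x"
    using vnorm_le_diff[OF carr(1) res] s1 by simp
  then have "\<mu> * vnorm q \<le> \<mu> * (vnorm (residual A b x) + \<theta> * residual_scale A b x)"
    using \<mu> by (intro mult_left_mono) auto
  moreover have scale0: "0 \<le> \<theta> * residual_scale A b v" for v
    using \<theta> by (simp add: residual_scale_def)
  then have "\<mu> * (\<theta> * residual_scale A b x) \<le> 1 / 80 * (\<theta> * residual_scale A b x)"
    using \<mu> by (intro mult_right_mono) auto
  ultimately have \<mu>q: "\<mu> * vnorm q \<le> \<mu> * vnorm (residual A b x) + (\<theta> * residual_scale A b x) / 80"
    by (simp add: algebra_simps)
  have Ax: "A *\<^sub>v w = A *\<^sub>v x + A *\<^sub>v e"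
    unfolding w_def using A x carr by (simp add: mult_add_distrib_mat_vec)
  have Ax': "A *\<^sub>v (x' - w) = A *\<^sub>v x' - A *\<^sub>v w"
    by (rule mult_minus_distrib_mat_vec[OF A x' carr(3)])
  have "residual A b x' = ((q - A *\<^sub>v e) - (q - residual A b x)) - A *\<^sub>v (x' - w)"
    unfolding Ax' Ax residual_def using A b x x' carr by (intro eq_vecI) auto
  then have "vnorm (residual A b x') \<le> vnorm (q - A *\<^sub>v e) + vnorm (q - residual A b x) + vnorm (A *\<^sub>v (x' - w))"
    using vnorm_triangle_diff[of "(q - A *\<^sub>v e) - (q - residual A b x)" n "A *\<^sub>v (x' - w)"]
      vnorm_triangle_diff[of "q - A *\<^sub>v e" n "q - residual A b x"] A x' carr res by simp
  moreover have "vnorm (A *\<^sub>v (x' - w)) \<le> \<theta> * (\<alpha> * vnorm w)"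
    using vnorm_mult_mat_vec_le_fro[OF A, of "x' - w"] mult_left_mono[OF s2 \<alpha>0] x' carr
    by (simp add: \<alpha>_def algebra_simps)
  moreover have "\<theta> * (\<alpha> * vnorm x') \<le> \<theta> * residual_scale A b x'"
    using \<theta> by (intro mult_left_mono) (auto simp: residual_scale_def \<alpha>_def)
  moreover have "0 \<le> \<mu> * vnorm (residual A b x)"
    using \<mu> by simp
  ultimately show ?thesis
    using corr s1 \<alpha>w scale \<mu>q scale0[of x] scale0[of x'] unfolding defs by linarith
qed

section \<open>Condition numbers, embeddings and rounding errors\<close>

lemma sigma_min_le_of_kappa_ge:
  assumes X: "X \<in> carrier_mat n k" "1 \<le> k" and c: "0 \<le> c" and ge: "1 \<le> ereal c * kappa X"
  shows "sigma_min X \<le> c * spec_norm X"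
proof (cases "sigma_min X = 0")
  case True
  then show ?thesis
    using c spec_norm_nonneg[OF X] by simp
next
  case False
  then have "0 < sigma_min X" "1 \<le> c * (spec_norm X / sigma_min X)"
    using sigma_min_nonneg[OF X] ge by (simp_all add: kappa_def one_ereal_def)
  then show ?thesis
    by (simp add: field_simps)
qed

lemma spec_norm_le_of_kappa_le:
  assumes X: "X \<in> carrier_mat n k" "1 \<le> k" and c: "0 < c" and le: "ereal c * kappa X \<le> ereal B"
  shows "0 < sigma_min X" and "c * spec_norm X \<le> B * sigma_min X"
proof -
  have "sigma_min X \<noteq> 0"
    using le c by (auto simp: kappa_def)
  then show pos: "0 < sigma_min X"
    using sigma_min_nonneg[OF X] by simp
  have "c * (spec_norm X / sigma_min X) \<le> B"
    using le pos by (simp add: kappa_def)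
  then show "c * spec_norm X \<le> B * sigma_min X"
    using pos by (simp add: field_simps)
qed

text \<open>A finite value of the factor excludes the degenerate cases \<open>sigma_min M = 0\<close> and
  \<open>A d = 0\<close> with nonzero numerator of \<open>tau_bar\<close>.  If the numerator and \<open>A d\<close> both vanish, the
  convention that 0 over 0 is 0 in \<^typ>\<open>ereal\<close> makes the product equation for \<open>\<tau>\<close> true as well.\<close>

lemma Lambda1_finite:
  assumes M: "M \<in> carrier_mat n n" "1 \<le> n" and \<epsilon>: "0 < \<epsilon>" "\<epsilon> < 1" and Q: "0 < Q"
    and Z: "Z_hat c \<in> carrier_mat n k" "1 \<le> k"
    and fin: "Lambda1 Q \<epsilon> A M c \<le> ereal \<delta>"
  obtains \<tau> where "0 \<le> \<tau>"
    and "spec_norm (Z_hat c) * fro_norm A * vnorm (y_hat c) = \<tau> * vnorm (A *\<^sub>v d_hat c)"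
    and "0 < sigma_min M"
    and "Lambda1 Q \<epsilon> A M c = ereal ((1 + \<epsilon>) / (1 - \<epsilon>) * Q * (spec_norm M / sigma_min M) * (1 + \<tau>))"
proof -
  define E where "E = spec_norm (Z_hat c) * fro_norm A * vnorm (y_hat c)"
  define a where "a = vnorm (A *\<^sub>v d_hat c)"
  have E: "0 \<le> E"
    using spec_norm_nonneg[OF Z] by (simp add: E_def)
  have a: "0 \<le> a"
    by (simp add: a_def)
  have tau: "tau_bar A c = ereal E / ereal a"
    by (simp add: tau_bar_def E_def a_def)
  have tau0: "0 \<le> tau_bar A c"
    unfolding tau using E a by (cases "a = 0"; cases "E = 0") (auto simp: divide_ereal_def)
  define D where "D = (1 + \<epsilon>) / (1 - \<epsilon>) * Q"
  have D: "0 < D"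
    using \<epsilon> Q by (simp add: D_def)
  have L: "Lambda1 Q \<epsilon> A M c = ereal D * kappa M * (1 + tau_bar A c)"
    by (simp add: Lambda1_def D_def)
  have pos_sum: "0 < 1 + tau_bar A c"
    using tau0 by (cases "tau_bar A c") (auto simp: one_ereal_def)
  have "sigma_min M \<noteq> 0"
  proof
    assume "sigma_min M = 0"
    then have "Lambda1 Q \<epsilon> A M c = \<infinity>"
      using D pos_sum by (simp add: L kappa_def)
    then show False
      using fin by simp
  qed
  then have \<sigma>: "0 < sigma_min M"
    using sigma_min_nonneg[OF M] by simp
  define \<kappa> where "\<kappa> = spec_norm M / sigma_min M"
  have \<kappa>: "0 < \<kappa>"
    using \<sigma> sigma_min_le_spec_norm[OF M] by (simp add: \<kappa>_def)
  have L': "Lambda1 Q \<epsilon> A M c = ereal (D * \<kappa>) * (1 + tau_bar A c)"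
    using \<sigma> by (simp add: L kappa_def \<kappa>_def)
  have "tau_bar A c \<noteq> \<infinity>"
  proof
    assume "tau_bar A c = \<infinity>"
    then have "Lambda1 Q \<epsilon> A M c = \<infinity>"
      using D \<kappa> by (simp add: L')
    then show False
      using fin by simp
  qed
  then obtain \<tau> where \<tau>: "tau_bar A c = ereal \<tau>" "0 \<le> \<tau>"
    using tau0 by (cases "tau_bar A c") auto
  have "E = \<tau> * a"
  proof (cases "a = 0")
    case True
    then show ?thesis
      using \<tau>(1) E unfolding tau by (cases "E = 0") (auto simp: divide_ereal_def)
  next
    case False
    then show ?thesis
      using \<tau>(1) unfolding tau by auto
  qed
  then show thesis
    using that[of \<tau>] \<tau> \<sigma> L' by (simp add: E_def a_def D_def \<kappa>_def one_ereal_def)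
qed

lemma minv_right_inverse:
  assumes M: "M \<in> carrier_mat n n" and inv: "invertible_mat M"
  shows "minv M \<in> carrier_mat n n" and "M * minv M = 1\<^sub>m n"
proof -
  obtain B where B: "inverts_mat M B" "inverts_mat B M"
    using inv unfolding invertible_mat_def by blast
  have MB: "M * B = 1\<^sub>m n" and BM: "B * M = 1\<^sub>m (dim_row B)"
    using B M unfolding inverts_mat_def by auto
  have "dim_col B = n"
    using arg_cong[OF MB, of dim_col] by simp
  moreover have "dim_row B = n"
    using arg_cong[OF BM, of dim_col] M by simp
  ultimately have Bc: "B \<in> carrier_mat n n"
    by auto
  then have "M \<in> Units (ring_mat TYPE(real) n ())"
    using M MB BM unfolding Units_def by (auto simp: ring_mat_def)
  then obtain C where "mat_inverse M = Some C"
    using mat_inverse(1)[OF M, of "()"] by (cases "mat_inverse M") auto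
  then show "minv M \<in> carrier_mat n n" "M * minv M = 1\<^sub>m n"
    using mat_inverse(2)[OF M] by (auto simp: minv_def)
qed

lemma col_aug_0:
  assumes "v \<in> carrier_vec n" shows "col (aug v X) 0 = v"
  using assms by (simp add: aug_def)

lemma col_aug_Suc:
  assumes "v \<in> carrier_vec n" "X \<in> carrier_mat n k" "j < k"
  shows "col (aug v X) (Suc j) = col X j"
  using assms by (simp add: aug_def col_carrier_vec)

lemma subspace_embedding_bounds:
  assumes emb: "subspace_embedding \<epsilon> S (vec_space.col_space n (aug b W))"
    and \<epsilon>: "0 < \<epsilon>" "\<epsilon> < 1"
    and b: "b \<in> carrier_vec n" and W: "W \<in> carrier_mat n k" and w: "w \<in> carrier_vec k"
  shows "sqrt (1 - \<epsilon>) * vnorm (a \<cdot>\<^sub>v b + W *\<^sub>v w) \<le> vnorm (S *\<^sub>v (a \<cdot>\<^sub>v b + W *\<^sub>v w))"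
    and "vnorm (S *\<^sub>v (a \<cdot>\<^sub>v b + W *\<^sub>v w)) \<le> sqrt (1 + \<epsilon>) * vnorm (a \<cdot>\<^sub>v b + W *\<^sub>v w)"
proof -
  let ?v = "a \<cdot>\<^sub>v b + W *\<^sub>v w"
  have "aug b W *\<^sub>v vCons a w = ?v"
    by (rule aug_mult_vCons[OF b W w])
  moreover have "vCons a w \<in> carrier_vec (dim_col (aug b W))"
    using aug_carrier[OF b W] w by simp
  moreover have "?v \<in> carrier_vec (dim_row (aug b W))"
    using aug_carrier[OF b W] b W w by simp
  ultimately have "?v \<in> vec_space.col_space n (aug b W)"
    unfolding vec_space.col_space_eq[OF aug_carrier[OF b W]] by blast
  then have "(1 - \<epsilon>) * (vnorm ?v)\<^sup>2 \<le> (vnorm (S *\<^sub>v ?v))\<^sup>2"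
    and "(vnorm (S *\<^sub>v ?v))\<^sup>2 \<le> (1 + \<epsilon>) * (vnorm ?v)\<^sup>2"
    using emb unfolding subspace_embedding_def by auto
  note this[THEN real_sqrt_le_mono]
  then show "sqrt (1 - \<epsilon>) * vnorm ?v \<le> vnorm (S *\<^sub>v ?v)"
    and "vnorm (S *\<^sub>v ?v) \<le> sqrt (1 + \<epsilon>) * vnorm ?v"
    by (simp_all add: real_sqrt_mult)
qed

text \<open>The perturbed sketch differs from the exact one by the error of forming it and by the backward
  error of the least squares solver, which is relative to the already perturbed data; this is the
  origin of the factor 3.\<close>

lemma two_rounding_errors:
  assumes v: "v \<in> carrier_vec n" and p: "p \<in> carrier_vec n" and q: "q \<in> carrier_vec n"
    and p_le: "vnorm p \<le> e1 * vnorm v" "e1 \<le> \<theta>"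
    and q_le: "vnorm q \<le> e2 * vnorm (v + p)" "e2 \<le> \<theta>"
    and \<theta>: "0 \<le> \<theta>" "\<theta> \<le> 1"
  shows "vnorm (((v + p) + q) - v) \<le> 3 * \<theta> * vnorm v"
proof -
  have p': "vnorm p \<le> \<theta> * vnorm v"
    using p_le(1) mult_right_mono[OF p_le(2) vnorm_nonneg[of v]] by linarith
  have "vnorm (v + p) \<le> 2 * vnorm v"
    using vnorm_triangle[OF v p] p' mult_right_mono[OF \<theta>(2) vnorm_nonneg[of v]] by linarith
  then have "\<theta> * vnorm (v + p) \<le> \<theta> * (2 * vnorm v)"
    using \<theta> by (intro mult_left_mono) auto
  then have "vnorm q \<le> \<theta> * (2 * vnorm v)"
    using q_le(1) mult_right_mono[OF q_le(2) vnorm_nonneg[of "v + p"]] by linarith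
  moreover have "((v + p) + q) - v = p + q"
    using v p q by (intro eq_vecI) auto
  ultimately show ?thesis
    using vnorm_triangle[OF p q] p' by simp
qed

section \<open>One restart cycle\<close>

lemma least_squares_residual_of_cycle:
  assumes n: "1 \<le> n" and \<epsilon>: "0 < \<epsilon>" "\<epsilon> < 1" and \<theta>: "0 < \<theta>" "\<theta> \<le> 1"
    and S: "S \<in> carrier_mat s n" and dims: "cycle_dims n s m c"
    and C: "model_C \<epsilon>C S c" "\<epsilon>C \<le> \<theta>" and g: "model_g \<epsilon>g S c" "\<epsilon>g \<le> \<theta>"
    and LS: "model_LS \<epsilon>ls S c" "\<epsilon>ls \<le> \<theta>"
    and emb: "subspace_embedding \<epsilon> S (vec_space.col_space n (aug (bp_hat c) (W_hat c)))"
    and near: "\<forall>\<phi>>0. ereal (\<theta> * sqrt ((1 - \<epsilon>) / (1 + \<epsilon>))) *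
      kappa (aug (\<phi> \<cdot>\<^sub>v bp_hat c) (W_hat c)) \<ge> 1"
    and pos: "0 < sigma_min (W_hat c)"
    and small: "4000 * sqrt ((1 + \<epsilon>) / (1 - \<epsilon>)) * real (steps c) * \<theta> * spec_norm (W_hat c)
      \<le> sigma_min (W_hat c)"
  shows "vnorm (bp_hat c - W_hat c *\<^sub>v y_hat c)
    \<le> 28 * sqrt ((1 + \<epsilon>) / (1 - \<epsilon>)) * real (steps c) * \<theta> *
      (vnorm (bp_hat c) + spec_norm (W_hat c) * vnorm (y_hat c))"
proof -
  define k where "k = steps c"
  have k: "1 \<le> k" and W: "W_hat c \<in> carrier_mat n k" and b: "bp_hat c \<in> carrier_vec n"
    and y: "y_hat c \<in> carrier_vec k" and Cc: "C_hat c \<in> carrier_mat s k" and gc: "g_hat c \<in> carrier_vec s"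
    using dims by (auto simp: cycle_dims_def k_def)
  have rowS: "dim_row S = s"
    using S by simp
  obtain \<Delta>C where \<Delta>C: "\<Delta>C \<in> carrier_mat s k" "C_hat c = S * W_hat c + \<Delta>C"
    and \<Delta>C_le: "\<And>j. j < k \<Longrightarrow> vnorm (col \<Delta>C j) \<le> \<epsilon>C * vnorm (S *\<^sub>v col (W_hat c) j)"
    using C(1) unfolding model_C_def rowS k_def[symmetric] by blast
  obtain \<Delta>g where \<Delta>g: "\<Delta>g \<in> carrier_vec s" "g_hat c = S *\<^sub>v bp_hat c + \<Delta>g"
      "vnorm \<Delta>g \<le> \<epsilon>g * vnorm (S *\<^sub>v bp_hat c)"
    using g(1) unfolding model_g_def rowS by blast
  obtain \<Delta>g' \<Delta>C' where \<Delta>': "\<Delta>g' \<in> carrier_vec s" "\<Delta>C' \<in> carrier_mat s k"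
    and argmin: "is_arg_min (\<lambda>y. vnorm ((g_hat c + \<Delta>g') - (C_hat c + \<Delta>C') *\<^sub>v y))
          (\<lambda>y. y \<in> carrier_vec k) (y_hat c)"
    and \<Delta>'_le: "\<And>j. j < k + 1 \<Longrightarrow>
           vnorm (col (aug \<Delta>g' \<Delta>C') j) \<le> \<epsilon>ls * vnorm (col (aug (g_hat c) (C_hat c)) j)"
    using LS(1) unfolding model_LS_def rowS k_def[symmetric] by blast
  define gt where "gt = g_hat c + \<Delta>g'"
  define Ct where "Ct = C_hat c + \<Delta>C'"
  have gt: "gt \<in> carrier_vec s" and Ct: "Ct \<in> carrier_mat s k"
    using gc Cc \<Delta>' by (auto simp: gt_def Ct_def)
  have SW: "S * W_hat c \<in> carrier_mat s k"
    using S W by simp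
  have err_g: "vnorm (gt - S *\<^sub>v bp_hat c) \<le> 3 * \<theta> * vnorm (S *\<^sub>v bp_hat c)"
  proof -
    have "vnorm \<Delta>g' \<le> \<epsilon>ls * vnorm (S *\<^sub>v bp_hat c + \<Delta>g)"
      using \<Delta>'_le[of 0] by (simp add: col_aug_0[OF \<Delta>'(1)] col_aug_0[OF gc] flip: \<Delta>g(2))
    then show ?thesis
      unfolding gt_def \<Delta>g(2) using \<theta> S b
      by (intro two_rounding_errors[OF _ \<Delta>g(1) \<Delta>'(1) \<Delta>g(3) g(2) _ LS(2)]) auto
  qed
  have err_C: "vnorm (col (Ct - S * W_hat c) j) \<le> 3 * \<theta> * vnorm (S *\<^sub>v col (W_hat c) j)"
    if j: "j < k" for j
  proof -
    have colSW: "col (S * W_hat c) j = S *\<^sub>v col (W_hat c) j"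
      using j S W by (intro eq_vecI) auto
    have colC: "col (C_hat c) j = S *\<^sub>v col (W_hat c) j + col \<Delta>C j"
      unfolding \<Delta>C(2) colSW[symmetric] using j SW \<Delta>C(1) by (intro eq_vecI) auto
    have "col (Ct - S * W_hat c) j = (col (C_hat c) j + col \<Delta>C' j) - col (S * W_hat c) j"
      unfolding Ct_def using j S W Cc \<Delta>'(2) by (intro eq_vecI) (auto simp del: col_mult2)
    then have colCt: "col (Ct - S * W_hat c) j
        = ((S *\<^sub>v col (W_hat c) j + col \<Delta>C j) + col \<Delta>C' j) - S *\<^sub>v col (W_hat c) j"
      unfolding colC colSW .
    have "vnorm (col \<Delta>C' j) \<le> \<epsilon>ls * vnorm (S *\<^sub>v col (W_hat c) j + col \<Delta>C j)"
      using \<Delta>'_le[of "Suc j"] j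
      by (simp add: col_aug_Suc[OF \<Delta>'] col_aug_Suc[OF gc Cc] flip: colC)
    then show ?thesis
      unfolding colCt using \<theta> S j W \<Delta>C(1) \<Delta>'(2)
      by (intro two_rounding_errors[of _ s, OF _ _ _ \<Delta>C_le[OF j] C(2) _ LS(2)]) auto
  qed
  have min: "vnorm (gt - Ct *\<^sub>v y_hat c) \<le> vnorm (gt - Ct *\<^sub>v z)" if "z \<in> carrier_vec k" for z
    using argmin that unfolding is_arg_min_def gt_def Ct_def by force
  have ratio: "sqrt (1 + \<epsilon>) / sqrt (1 - \<epsilon>) = sqrt ((1 + \<epsilon>) / (1 - \<epsilon>))"
    by (simp add: real_sqrt_divide)
  have near': "sigma_min (aug (\<phi> \<cdot>\<^sub>v bp_hat c) (W_hat c))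
      \<le> \<theta> * spec_norm (aug (\<phi> \<cdot>\<^sub>v bp_hat c) (W_hat c))" if "0 < \<phi>" for \<phi>
  proof -
    have aug: "aug (\<phi> \<cdot>\<^sub>v bp_hat c) (W_hat c) \<in> carrier_mat n (Suc k)"
      using aug_carrier[OF _ W] b by simp
    have "sigma_min (aug (\<phi> \<cdot>\<^sub>v bp_hat c) (W_hat c))
        \<le> \<theta> * sqrt ((1 - \<epsilon>) / (1 + \<epsilon>)) * spec_norm (aug (\<phi> \<cdot>\<^sub>v bp_hat c) (W_hat c))"
      using near that \<theta> \<epsilon> by (intro sigma_min_le_of_kappa_ge[OF aug]) auto
    also have "\<dots> \<le> \<theta> * 1 * spec_norm (aug (\<phi> \<cdot>\<^sub>v bp_hat c) (W_hat c))"
      using \<theta> \<epsilon> spec_norm_nonneg[OF aug]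
      by (intro mult_right_mono mult_left_mono) (auto simp: field_simps)
    finally show ?thesis by simp
  qed
  show ?thesis
    unfolding k_def[symmetric] ratio[symmetric]
    using \<epsilon> small
    by (intro sketched_least_squares_residual[OF k W b S gt Ct y _ _ \<theta>(1)
          subspace_embedding_bounds(1)[OF emb \<epsilon> b W] subspace_embedding_bounds(2)[OF emb \<epsilon> b W]
          err_g err_C min near' pos])
      (auto simp: ratio k_def)
qed

text \<open>The constant in \<open>Q\<close> serves three purposes: it makes \<open>W\<close> well conditioned enough for the least
  squares bound, it forces \<open>\<theta>\<close> and \<open>\<mu>\<close> to be small enough for the absorption arguments, and it
  leaves room for the factor \<open>36 \<rho>\<close> between \<open>\<mu>\<close> and the reduction factor that the comparison
  of backward errors uses up.  The least squares bound contributes only the square root of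
  \<open>(1 + \<epsilon>) / (1 - \<epsilon>)\<close>, which is at most the ratio itself.\<close>

lemma cycle_residual_reduction:
  assumes n: "1 \<le> n" and \<epsilon>: "0 < \<epsilon>" "\<epsilon> < 1" and \<rho>: "1 \<le> \<rho>" and \<theta>: "0 \<le> \<theta>"
    and A: "A \<in> carrier_mat n n" and b: "b \<in> carrier_vec n"
    and M: "M \<in> carrier_mat n n" "invertible_mat M" and S: "S \<in> carrier_mat s n"
    and x: "x \<in> carrier_vec n" and x': "x' \<in> carrier_vec n"
    and dims: "cycle_dims n s m c" and step: "refinement_step \<theta> A b x c x'"
    and model: "rounding_model \<theta> A M S c"
    and near: "\<forall>\<phi>>0. ereal (\<theta> * sqrt ((1 - \<epsilon>) / (1 + \<epsilon>))) *
      kappa (aug (\<phi> \<cdot>\<^sub>v bp_hat c) (W_hat c)) \<ge> 1"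
    and Q: "Q = 4000 * \<rho> * real m * \<theta>"
    and kappa_W: "ereal (Q * sqrt ((1 + \<epsilon>) / (1 - \<epsilon>))) * kappa (W_hat c) \<le> 1 / 2"
    and emb: "subspace_embedding \<epsilon> S (vec_space.col_space n (aug (bp_hat c) (W_hat c)))"
    and \<Lambda>: "Lambda1 Q \<epsilon> A M c \<le> ereal (1 / 2)"
  obtains \<mu> \<Lambda>r where "Lambda1 Q \<epsilon> A M c = ereal \<Lambda>r" and "0 \<le> \<mu>" and "36 * \<rho> * \<mu> \<le> \<Lambda>r"
    and "vnorm (residual A b x') \<le> 18 * \<mu> * vnorm (residual A b x) + 10 * \<theta> * residual_scale A b x'"
proof -
  define k where "k = steps c"
  define \<gamma> where "\<gamma> = sqrt ((1 + \<epsilon>) / (1 - \<epsilon>))"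
  have k: "1 \<le> k" "k \<le> m" and Z: "Z_hat c \<in> carrier_mat n k" and W: "W_hat c \<in> carrier_mat n k"
    and bp: "bp_hat c \<in> carrier_vec n" and r: "r_hat c \<in> carrier_vec n"
    and y: "y_hat c \<in> carrier_vec k" and d: "d_hat c \<in> carrier_vec n"
    using dims by (auto simp: cycle_dims_def k_def)
  have \<gamma>: "1 \<le> \<gamma>" and \<gamma>_sq: "\<gamma> \<le> (1 + \<epsilon>) / (1 - \<epsilon>)"
  proof -
    have D: "1 \<le> (1 + \<epsilon>) / (1 - \<epsilon>)"
      using \<epsilon> by (simp add: field_simps)
    then show \<gamma>1: "1 \<le> \<gamma>"
      by (simp add: \<gamma>_def)
    have "\<gamma>\<^sup>2 = (1 + \<epsilon>) / (1 - \<epsilon>)"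
      unfolding \<gamma>_def using D by (intro real_sqrt_pow2) linarith
    then show "\<gamma> \<le> (1 + \<epsilon>) / (1 - \<epsilon>)"
      using mult_left_mono[OF \<gamma>1, of \<gamma>] \<gamma>1 by (simp add: power2_eq_square)
  qed
  \<comment> \<open>For \<open>\<theta> = 0\<close> the assumption on \<open>[\<phi> b, W]\<close> fails, as 0 times \<open>\<infinity>\<close> is 0 in \<^typ>\<open>ereal\<close>.\<close>
  have \<theta>pos: "0 < \<theta>"
  proof (rule ccontr)
    assume "\<not> 0 < \<theta>"
    then show False
      using near[rule_format, of 1] \<theta> by (simp add: zero_ereal_def[symmetric])
  qed
  have kR: "1 \<le> real k" "real k \<le> real m"
    using k by auto
  have Qk: "4000 * \<rho> * (real k * \<theta>) \<le> Q"
    unfolding Q using kR \<theta>pos \<rho> by (simp add: mult_left_mono mult_right_mono)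
  have k\<theta>: "4000 * (real k * \<theta>) \<le> Q"
  proof -
    have "1 * (real k * \<theta>) \<le> \<rho> * (real k * \<theta>)"
      using \<rho> \<theta>pos by (intro mult_right_mono) auto
    then show ?thesis
      using Qk by simp
  qed
  have k\<theta>0: "0 < real k * \<theta>" and \<theta>k: "\<theta> \<le> real k * \<theta>"
    using kR \<theta>pos by auto
  have Qpos: "0 < Q"
    using k\<theta> k\<theta>0 by linarith
  have half: "(1 / 2 :: ereal) = ereal (1 / 2)"
    by (metis ereal_divide numeral_eq_ereal one_ereal_def zero_neq_numeral)
  have \<sigma>W: "0 < sigma_min (W_hat c)" and QW: "Q * \<gamma> * spec_norm (W_hat c) \<le> 1 / 2 * sigma_min (W_hat c)"
    using spec_norm_le_of_kappa_le[OF W k(1) _ kappa_W[unfolded half]] Qpos \<gamma>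
    by (auto simp: \<gamma>_def[symmetric])
  have W_le: "sigma_min (W_hat c) \<le> spec_norm (W_hat c)"
    by (rule sigma_min_le_spec_norm[OF W k(1)])
  \<comment> \<open>A condition number is at least 1, so the assumption on that of \<open>W\<close> bounds \<open>Q\<close> itself.\<close>
  have Q_half: "Q \<le> 1 / 2"
  proof (rule ccontr)
    assume "\<not> Q \<le> 1 / 2"
    moreover have "Q * 1 \<le> Q * \<gamma>"
      using Qpos \<gamma> by (intro mult_left_mono) auto
    ultimately have "1 / 2 < Q * \<gamma>"
      by linarith
    then have "1 / 2 * spec_norm (W_hat c) < Q * \<gamma> * spec_norm (W_hat c)"
      using W_le \<sigma>W by (intro mult_strict_right_mono) simp_all
    then show False
      using QW W_le by simp
  qed
  have small: "4000 * \<gamma> * real k * \<theta> * spec_norm (W_hat c) \<le> sigma_min (W_hat c)"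
  proof -
    have "4000 * (real k * \<theta>) * (\<gamma> * spec_norm (W_hat c)) \<le> Q * (\<gamma> * spec_norm (W_hat c))"
      using k\<theta> \<gamma> W_le \<sigma>W by (intro mult_right_mono) auto
    then show ?thesis
      using QW \<sigma>W by (simp add: ac_simps)
  qed
  obtain \<epsilon>W \<epsilon>b \<epsilon>ls \<epsilon>S \<epsilon>x where eps: "\<epsilon>W \<le> \<theta>" "\<epsilon>b \<le> \<theta>" "\<epsilon>ls \<le> \<theta>" "\<epsilon>S \<le> \<theta>" "\<epsilon>x \<le> \<theta>"
    and models: "model_W \<epsilon>W A M c" "model_b \<epsilon>b M c" "model_C \<epsilon>S S c" "model_g \<epsilon>S S c"
      "model_LS \<epsilon>ls S c" "model_x \<epsilon>x c"
    using model unfolding rounding_model_def by blast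
  define N where "N = minv M"
  have N: "N \<in> carrier_mat n n" and MN: "M * N = 1\<^sub>m n"
    using minv_right_inverse[OF M] by (auto simp: N_def)
  note nn = spec_norm_nonneg[OF N n] spec_norm_nonneg[OF Z k(1)]
  have ls: "vnorm (bp_hat c - W_hat c *\<^sub>v y_hat c)
      \<le> 28 * \<gamma> * real k * \<theta> * (vnorm (bp_hat c) + spec_norm (W_hat c) * vnorm (y_hat c))"
    unfolding \<gamma>_def k_def
    by (rule least_squares_residual_of_cycle[OF n \<epsilon> \<theta>pos _ S dims models(3) eps(4) models(4) eps(4)
          models(5) eps(3) emb near \<sigma>W])
      (use k\<theta> \<theta>k Q_half small in \<open>auto simp: \<gamma>_def k_def\<close>)
  obtain \<Delta>W where \<Delta>W: "\<Delta>W \<in> carrier_mat n k" "W_hat c = N * A * Z_hat c + \<Delta>W"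
      "fro_norm \<Delta>W \<le> \<epsilon>W * spec_norm N * fro_norm A * fro_norm (Z_hat c)"
    using models(1) A unfolding model_W_def N_def k_def by auto
  obtain \<Delta>b where \<Delta>b: "\<Delta>b \<in> carrier_vec n" "bp_hat c = N *\<^sub>v r_hat c + \<Delta>b"
      "vnorm \<Delta>b \<le> \<epsilon>b * spec_norm N * vnorm (r_hat c)"
    using models(2) M unfolding model_b_def N_def by auto
  obtain \<Delta>d where \<Delta>d: "\<Delta>d \<in> carrier_vec n" "d_hat c = Z_hat c *\<^sub>v y_hat c + \<Delta>d"
      "vnorm \<Delta>d \<le> \<epsilon>x * spec_norm (Z_hat c) * vnorm (y_hat c)"
    using models(6) d unfolding model_x_def by auto
  have \<Delta>W_le: "fro_norm \<Delta>W \<le> \<theta> * spec_norm N * fro_norm A * fro_norm (Z_hat c)"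
    using \<Delta>W(3) mult_right_mono[OF eps(1), of "spec_norm N * fro_norm A * fro_norm (Z_hat c)"] nn
    by (simp add: mult.assoc)
  have \<Delta>b_le: "vnorm \<Delta>b \<le> \<theta> * spec_norm N * vnorm (r_hat c)"
    using \<Delta>b(3) mult_right_mono[OF eps(2), of "spec_norm N * vnorm (r_hat c)"] nn
    by (simp add: mult.assoc)
  have \<Delta>d_le: "vnorm \<Delta>d \<le> \<theta> * spec_norm (Z_hat c) * vnorm (y_hat c)"
    using \<Delta>d(3) mult_right_mono[OF eps(5), of "spec_norm (Z_hat c) * vnorm (y_hat c)"] nn
    by (simp add: mult.assoc)
  define E where "E = spec_norm (Z_hat c) * fro_norm A * vnorm (y_hat c)"
  have E: "0 \<le> E"
    using nn by (simp add: E_def)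
  obtain \<tau> where \<tau>: "0 \<le> \<tau>" "E = \<tau> * vnorm (A *\<^sub>v d_hat c)"
    and \<sigma>M: "0 < sigma_min M"
    and \<Lambda>_eq: "Lambda1 Q \<epsilon> A M c
      = ereal ((1 + \<epsilon>) / (1 - \<epsilon>) * Q * (spec_norm M / sigma_min M) * (1 + \<tau>))"
    unfolding E_def by (rule Lambda1_finite[OF M(1) n \<epsilon> Qpos Z k(1) \<Lambda>])
  define \<Lambda>r where "\<Lambda>r = (1 + \<epsilon>) / (1 - \<epsilon>) * Q * (spec_norm M / sigma_min M) * (1 + \<tau>)"
  define \<kappa> where "\<kappa> = spec_norm M / sigma_min M"
  have \<kappa>_ge: "spec_norm M * spec_norm N \<le> \<kappa>" and \<kappa>1: "1 \<le> \<kappa>"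
  proof -
    have "spec_norm N \<le> 1 / sigma_min M"
      using spec_norm_right_inverse(2)[OF M(1) N MN n] \<sigma>M by (simp add: field_simps)
    then have "spec_norm M * spec_norm N \<le> spec_norm M * (1 / sigma_min M)"
      using spec_norm_nonneg[OF M(1) n] by (rule mult_left_mono)
    then show "spec_norm M * spec_norm N \<le> \<kappa>"
      by (simp add: \<kappa>_def)
    then show "1 \<le> \<kappa>"
      using spec_norm_right_inverse(1)[OF M(1) N MN n] by linarith
  qed
  \<comment> \<open>The 84 is 3 times 28, the constants of the correction bound and the least squares bound.\<close>
  define \<beta> where "\<beta> = 84 * \<gamma> * (real k * \<theta>) * \<kappa>"
  define \<mu> where "\<mu> = \<beta> * (1 + \<tau>)"
  have \<beta>\<theta>: "\<theta> \<le> \<beta>"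
  proof -
    have "1 * 1 \<le> \<gamma> * \<kappa>"
      using \<gamma> \<kappa>1 by (intro mult_mono) auto
    then have "(real k * \<theta>) * 1 \<le> (real k * \<theta>) * (84 * (\<gamma> * \<kappa>))"
      using k\<theta>0 by (intro mult_left_mono) auto
    then show ?thesis
      using \<theta>k by (simp add: \<beta>_def ac_simps)
  qed
  then have \<beta>0: "0 \<le> \<beta>"
    using \<theta>pos by simp
  have \<mu>0: "0 \<le> \<mu>"
    using \<beta>0 \<tau> by (simp add: \<mu>_def)
  have \<mu>_\<Lambda>: "47 * (\<rho> * \<mu>) \<le> \<Lambda>r"
  proof -
    define t where "t = \<kappa> * (1 + \<tau>)"
    have t: "0 \<le> t"
      using \<kappa>1 \<tau>(1) by (simp add: t_def)
    have "47 * (\<rho> * \<mu>) = (47 * 84 / 4000) * ((4000 * \<rho> * (real k * \<theta>)) * (\<gamma> * t))"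
      by (simp add: \<mu>_def \<beta>_def t_def)
    also have "\<dots> \<le> 1 * ((4000 * \<rho> * (real k * \<theta>)) * (\<gamma> * t))"
      using \<rho> \<gamma> k\<theta>0 t by (intro mult_right_mono) auto
    also have "\<dots> \<le> 1 * (Q * (\<gamma> * t))"
      using Qk \<gamma> t by (intro mult_left_mono mult_right_mono) auto
    also have "\<dots> \<le> 1 * (Q * ((1 + \<epsilon>) / (1 - \<epsilon>) * t))"
      using \<gamma>_sq t Qpos by (intro mult_left_mono mult_right_mono) auto
    finally show ?thesis
      by (simp add: \<Lambda>r_def \<kappa>_def t_def ac_simps)
  qed
  have "\<Lambda>r \<le> 1 / 2"
    using \<Lambda> by (simp add: \<Lambda>_eq \<Lambda>r_def)
  moreover have \<rho>\<mu>: "1 * \<mu> \<le> \<rho> * \<mu>"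
    using \<rho> \<mu>0 by (rule mult_right_mono)
  ultimately have \<mu>_small: "\<mu> \<le> 1 / 80"
    using \<mu>_\<Lambda> by simp
  have corr: "vnorm (r_hat c - A *\<^sub>v d_hat c) \<le> \<beta> * (vnorm (r_hat c) + E)"
  proof -
    have "vnorm (r_hat c - A *\<^sub>v d_hat c)
        \<le> 3 * (28 * \<gamma> * real k * \<theta>) * (spec_norm M * spec_norm N) *
          (vnorm (r_hat c) + spec_norm (Z_hat c) * fro_norm A * vnorm (y_hat c))"
    proof (rule correction_residual[OF n k(1) A M(1) N MN r Z y \<Delta>W(1) \<Delta>W_le \<Delta>b(1) \<Delta>b_le \<Delta>d(1) \<Delta>d_le
          \<Delta>W(2) \<Delta>b(2) \<Delta>d(2) \<theta> _ _ ls])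
      show "real k * \<theta> \<le> 1"
        using k\<theta> Q_half by linarith
      have "1 * (28 * (real k * \<theta>)) \<le> \<gamma> * (28 * (real k * \<theta>))"
        using \<gamma> k\<theta>0 by (intro mult_right_mono) auto
      then show "28 * real k * \<theta> \<le> 28 * \<gamma> * real k * \<theta>"
        by (simp add: ac_simps)
    qed
    also have "\<dots> \<le> 3 * (28 * \<gamma> * real k * \<theta>) * \<kappa> * (vnorm (r_hat c) + E)"
      unfolding E_def[symmetric] using \<kappa>_ge E \<gamma> \<theta> by (intro mult_right_mono mult_left_mono) auto
    also have "\<dots> = \<beta> * (vnorm (r_hat c) + E)"
      by (simp add: \<beta>_def)
    finally show ?thesis .
  qed
  note rel = correction_residual_relative[OF A r d corr \<tau>(2,1) \<beta>0 \<mu>_small[unfolded \<mu>_def],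
      folded \<mu>_def]
  have d_small: "\<theta> * (fro_norm A * vnorm (d_hat c)) \<le> 4 * \<mu> * vnorm (r_hat c)"
  proof -
    have "vnorm (d_hat c) \<le> (1 + \<theta>) * (spec_norm (Z_hat c) * vnorm (y_hat c))"
      unfolding \<Delta>d(2)
      using vnorm_triangle[of "Z_hat c *\<^sub>v y_hat c" n \<Delta>d] \<Delta>d(1) \<Delta>d_le vnorm_mult_mat_vec_le_spec[OF Z y] Z y
      by (simp add: algebra_simps)
    also have "\<dots> \<le> 2 * (spec_norm (Z_hat c) * vnorm (y_hat c))"
      using k\<theta> \<theta>k Q_half nn by (intro mult_right_mono) auto
    finally have "fro_norm A * vnorm (d_hat c) \<le> fro_norm A * (2 * (spec_norm (Z_hat c) * vnorm (y_hat c)))"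
      by (rule mult_left_mono) simp
    also have "\<dots> = 2 * E"
      by (simp add: E_def)
    finally have "\<theta> * (fro_norm A * vnorm (d_hat c)) \<le> \<beta> * (2 * E)"
      by (rule mult_mono[OF \<beta>\<theta> _ \<beta>0]) simp
    then show ?thesis
      using rel(2) by linarith
  qed
  show thesis
  proof (rule that[OF \<Lambda>_eq[folded \<Lambda>r_def] \<mu>0])
    show "36 * \<rho> * \<mu> \<le> \<Lambda>r"
      using \<mu>_\<Lambda> \<rho>\<mu> \<mu>0 by simp
    show "vnorm (residual A b x') \<le> 18 * \<mu> * vnorm (residual A b x) + 10 * \<theta> * residual_scale A b x'"
      using k\<theta> \<theta>k Q_half
      by (intro refined_residual[OF A b x x' r d step \<theta> _ \<mu>0 \<mu>_small rel(1) d_small]) linarith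
  qed
qed

lemma residual_le_residual_scale:
  assumes A: "A \<in> carrier_mat n n" and b: "b \<in> carrier_vec n" and x: "x \<in> carrier_vec n"
  shows "vnorm (residual A b x) \<le> residual_scale A b x"
proof -
  have "A *\<^sub>v x \<in> carrier_vec n"
    using A x by auto
  then show ?thesis
    using vnorm_triangle_diff[OF b, of "A *\<^sub>v x"] vnorm_mult_mat_vec_le_fro[OF A x]
    by (simp add: residual_def residual_scale_def)
qed

text \<open>Above the level \<open>Q\<close> the term \<open>10 \<theta> residual_scale A b x'\<close> is at most half of the new residual,
  so that it can be absorbed and \<open>36 \<mu>\<close> is a reduction factor for the residual.  The surplus
  \<open>\<rho>\<close> in \<open>\<Lambda>\<close> pays for the change of denominators.\<close>

lemma backward_error_reduction:
  assumes A: "A \<in> carrier_mat n n" and b: "b \<in> carrier_vec n" and x: "x \<in> carrier_vec n"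
    and \<rho>: "1 \<le> \<rho>" and \<mu>: "0 \<le> \<mu>" "36 * \<rho> * \<mu> \<le> \<Lambda>" and Q: "20 * \<theta> \<le> Q" "0 \<le> Q"
    and res: "vnorm (residual A b x') \<le> 18 * \<mu> * vnorm (residual A b x) + 10 * \<theta> * residual_scale A b x'"
  shows "backward_error A b x' \<le> Q \<or>
    (vnorm (residual A b x') \<le> \<Lambda> * vnorm (residual A b x) \<and>
     (residual_scale A b x \<le> \<rho> * residual_scale A b x' \<longrightarrow>
       backward_error A b x' \<le> \<Lambda> * backward_error A b x))"
proof (cases "backward_error A b x' \<le> Q")
  case False
  define s' where "s' = residual_scale A b x'"
  define s where "s = residual_scale A b x"
  define R where "R = vnorm (residual A b x)"
  define R' where "R' = vnorm (residual A b x')"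
  have s0: "0 \<le> s" "0 \<le> s'" and R0: "0 \<le> R"
    by (auto simp: s_def s'_def R_def residual_scale_def)
  have be: "backward_error A b x' = R' / s'" "backward_error A b x = R / s"
    by (auto simp: backward_error_def R'_def s'_def R_def s_def)
  have s': "0 < s'"
    using False s0 Q by (cases "s' = 0") (auto simp: be)
  have "Q * s' < R'"
    using False s' by (simp add: be field_simps)
  moreover have "20 * \<theta> * s' \<le> Q * s'"
    using Q s' by (intro mult_right_mono) auto
  ultimately have R': "R' \<le> 36 * \<mu> * R"
    using res by (simp add: R'_def R_def s'_def)
  have "36 * \<mu> * 1 \<le> 36 * \<mu> * \<rho>"
    using \<mu> \<rho> by (intro mult_left_mono) auto
  then have \<mu>\<Lambda>: "36 * \<mu> \<le> \<Lambda>"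
    using \<mu> by (simp add: ac_simps)
  then have "R' \<le> \<Lambda> * R"
    using R' R0 by (meson mult_right_mono order_trans)
  moreover have "R' / s' \<le> \<Lambda> * (R / s)" if "s \<le> \<rho> * s'"
  proof (cases "s = 0")
    case True
    \<comment> \<open>A vanishing scale makes the old backward error 0 by convention, but then the old
      residual, and with it the new one, vanishes as well.\<close>
    then have "R = 0"
      using residual_le_residual_scale[OF A b x] R0 by (intro antisym) (simp_all add: R_def s_def)
    then show ?thesis
      using R' s' by (simp add: divide_nonpos_pos)
  next
    case s: False
    have "R' / s' \<le> 36 * \<mu> * R / s'"
      using R' s' by (intro divide_right_mono) auto
    also have "\<dots> = 36 * \<mu> * R * (1 / s')"
      by simp
    also have "\<dots> \<le> 36 * \<mu> * R * (\<rho> / s)"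
      using that s s' s0 \<mu> R0 by (intro mult_left_mono) (auto simp: field_simps)
    also have "\<dots> = 36 * \<rho> * \<mu> * (R / s)"
      by simp
    also have "\<dots> \<le> \<Lambda> * (R / s)"
      using \<mu>(2) R0 s0 by (intro mult_right_mono) auto
    finally show ?thesis .
  qed
  ultimately show ?thesis
    unfolding be by (simp add: R_def R'_def s_def s'_def)
qed simp

lemma cycle_reduces_backward_error:
  assumes n: "1 \<le> n" and \<epsilon>: "0 < \<epsilon>" "\<epsilon> < 1" and \<rho>: "1 \<le> \<rho>" and \<theta>: "0 \<le> \<theta>"
    and A: "A \<in> carrier_mat n n" and b: "b \<in> carrier_vec n"
    and M: "M \<in> carrier_mat n n" "invertible_mat M" and S: "S \<in> carrier_mat s n"
    and x: "x \<in> carrier_vec n" and x': "x' \<in> carrier_vec n"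
    and dims: "cycle_dims n s m c" and step: "refinement_step \<theta> A b x c x'"
    and model: "rounding_model \<theta> A M S c"
    and near: "\<forall>\<phi>>0. ereal (\<theta> * sqrt ((1 - \<epsilon>) / (1 + \<epsilon>))) *
      kappa (aug (\<phi> \<cdot>\<^sub>v bp_hat c) (W_hat c)) \<ge> 1"
    and Q: "Q = 4000 * \<rho> * real m * \<theta>"
    and kappa_W: "ereal (Q * sqrt ((1 + \<epsilon>) / (1 - \<epsilon>))) * kappa (W_hat c) \<le> 1 / 2"
    and emb: "subspace_embedding \<epsilon> S (vec_space.col_space n (aug (bp_hat c) (W_hat c)))"
    and \<Lambda>: "Lambda1 Q \<epsilon> A M c \<le> ereal (1 / 2)"
  shows "backward_error A b x' \<le> Q \<or>
    (ereal (vnorm (residual A b x')) \<le> Lambda1 Q \<epsilon> A M c * ereal (vnorm (residual A b x)) \<and>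
     (residual_scale A b x \<le> \<rho> * residual_scale A b x' \<longrightarrow>
       ereal (backward_error A b x') \<le> Lambda1 Q \<epsilon> A M c * ereal (backward_error A b x)))"
proof -
  obtain \<mu> \<Lambda>r where \<Lambda>r: "Lambda1 Q \<epsilon> A M c = ereal \<Lambda>r" and \<mu>: "0 \<le> \<mu>" "36 * \<rho> * \<mu> \<le> \<Lambda>r"
    and res: "vnorm (residual A b x') \<le> 18 * \<mu> * vnorm (residual A b x) + 10 * \<theta> * residual_scale A b x'"
    by (rule cycle_residual_reduction[OF assms])
  have "1 \<le> real m"
    using dims by (auto simp: cycle_dims_def)
  then have "1 * 1 \<le> \<rho> * real m"
    using \<rho> by (intro mult_mono) auto
  then have "20 * \<theta> \<le> (4000 * (\<rho> * real m)) * \<theta>"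
    using \<theta> by (intro mult_right_mono) auto
  then have "20 * \<theta> \<le> Q"
    by (simp add: Q)
  moreover from this have "0 \<le> Q"
    using \<theta> by linarith
  ultimately show ?thesis
    using backward_error_reduction[OF A b x \<rho> \<mu> _ _ res] by (simp add: \<Lambda>r)
qed

lemma dim_poly_nonneg: "dim_poly d p \<Longrightarrow> 0 \<le> p n s m"
  by (induction rule: dim_poly.induct) auto

section \<open>Reduction of the backward error in all embedded cycles\<close>

theorem theorem2:
  shows "\<exists>(e::nat) \<delta>::real. 0 < \<delta> \<and> \<delta> < 1 \<and>
    (\<forall>(d::nat) p (\<rho>::real). dim_poly d p \<and> 1 \<le> \<rho> \<longrightarrow>
      (\<exists>q. dim_poly (d + e) q \<and>
        (\<forall>(n::nat) (s::nat) (m::nat) (u::real) (\<epsilon>::real) A b M\<^sub>L (M\<^sub>R :: real mat) (P :: real mat measure) (\<eta>::real)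
           (x :: real mat \<Rightarrow> nat \<Rightarrow> real vec) (c :: real mat \<Rightarrow> nat \<Rightarrow> sgmres_cycle) (I :: nat set).
           1 \<le> n \<and> 0 < u \<and> u < 1 \<and> 0 < \<epsilon> \<and> \<epsilon> < 1 \<and>
           A \<in> carrier_mat n n \<and> invertible_mat A \<and> b \<in> carrier_vec n \<and>
           M\<^sub>L \<in> carrier_mat n n \<and> invertible_mat M\<^sub>L \<and>
           M\<^sub>R \<in> carrier_mat n n \<and> invertible_mat M\<^sub>R \<and>
           prob_space P \<and> space P \<subseteq> carrier_mat s n \<and>
           I \<subseteq> {1..} \<and>
           (\<forall>S\<in>space P. \<forall>i\<ge>1.
              x S i \<in> carrier_vec n \<and>
              cycle_dims n s m (c S i) \<and>
              refinement_step (u * p n s m) A b (x S i) (c S i) (x S (i + 1)) \<and>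
              rounding_model (u * p n s m) A M\<^sub>L S (c S i) \<and>
              (\<forall>\<phi>>0. ereal (u * p n s m * sqrt ((1 - \<epsilon>) / (1 + \<epsilon>))) *
                 kappa (aug (\<phi> \<cdot>\<^sub>v bp_hat (c S i)) (W_hat (c S i))) \<ge> 1) \<and>
              ereal (u * q n s m * sqrt ((1 + \<epsilon>) / (1 - \<epsilon>))) * kappa (W_hat (c S i)) \<le> 1 / 2 \<and>
              ereal (u * q n s m) * kappa (Z_hat (c S i)) \<le> 1 / 2) \<and>
           with_prob P \<eta> (\<lambda>S. \<forall>i\<in>I. subspace_embedding \<epsilon> S
             (vec_space.col_space n (aug (bp_hat (c S i)) (W_hat (c S i)))))
           \<longrightarrow>
           with_prob P \<eta> (\<lambda>S. \<forall>i\<in>I.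
             Lambda1 (u * q n s m) \<epsilon> A M\<^sub>L (c S i) \<le> ereal \<delta> \<longrightarrow>
               backward_error A b (x S (i + 1)) \<le> u * q n s m \<or>
               (ereal (vnorm (residual A b (x S (i + 1)))) \<le>
                  Lambda1 (u * q n s m) \<epsilon> A M\<^sub>L (c S i) * ereal (vnorm (residual A b (x S i))) \<and>
                (residual_scale A b (x S i) \<le> \<rho> * residual_scale A b (x S (i + 1)) \<longrightarrow>
                 ereal (backward_error A b (x S (i + 1))) \<le>
                  Lambda1 (u * q n s m) \<epsilon> A M\<^sub>L (c S i) * ereal (backward_error A b (x S i))))))))"
proof (rule exI[of _ 1], rule exI[of _ "1 / 2"], intro conjI allI impI, goal_cases)
  case (3 d p \<rho>)
  then have p: "dim_poly d p" and \<rho>: "1 \<le> \<rho>"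
    by auto
  \<comment> \<open>The factor \<open>m\<close> bounds the number of columns; it accounts for the one extra degree.\<close>
  define q where "q = (\<lambda>n s m. (4000 * \<rho>) * real m * p n s m)"
  have "dim_poly (0 + 1 + d) q"
    unfolding q_def using \<rho>
    by (intro dim_poly_mult[OF dim_poly_mult[OF dim_poly_const dim_poly_m] p]) simp
  then have q: "dim_poly (d + 1) q"
    by (simp add: add.commute)
  show ?case
  proof (rule exI[of _ q], intro conjI q allI impI, elim conjE)
    fix n s m :: nat and u \<epsilon> :: real and A b M\<^sub>L and M\<^sub>R :: "real mat" and P :: "real mat measure"
      and \<eta> :: real and x :: "real mat \<Rightarrow> nat \<Rightarrow> real vec" and c :: "real mat \<Rightarrow> nat \<Rightarrow> sgmres_cycle"
      and I :: "nat set"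
    assume n: "1 \<le> n" and u: "0 < u" and \<epsilon>: "0 < \<epsilon>" "\<epsilon> < 1"
      and A: "A \<in> carrier_mat n n" and b: "b \<in> carrier_vec n"
      and M: "M\<^sub>L \<in> carrier_mat n n" "invertible_mat M\<^sub>L"
      and P: "space P \<subseteq> carrier_mat s n" and I: "I \<subseteq> {1..}"
      and cycles: "\<forall>S\<in>space P. \<forall>i\<ge>1.
              x S i \<in> carrier_vec n \<and>
              cycle_dims n s m (c S i) \<and>
              refinement_step (u * p n s m) A b (x S i) (c S i) (x S (i + 1)) \<and>
              rounding_model (u * p n s m) A M\<^sub>L S (c S i) \<and>
              (\<forall>\<phi>>0. ereal (u * p n s m * sqrt ((1 - \<epsilon>) / (1 + \<epsilon>))) *
                 kappa (aug (\<phi> \<cdot>\<^sub>v bp_hat (c S i)) (W_hat (c S i))) \<ge> 1) \<and>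
              ereal (u * q n s m * sqrt ((1 + \<epsilon>) / (1 - \<epsilon>))) * kappa (W_hat (c S i)) \<le> 1 / 2 \<and>
              ereal (u * q n s m) * kappa (Z_hat (c S i)) \<le> 1 / 2"
      and emb: "with_prob P \<eta> (\<lambda>S. \<forall>i\<in>I. subspace_embedding \<epsilon> S
             (vec_space.col_space n (aug (bp_hat (c S i)) (W_hat (c S i)))))"
    obtain E where E: "E \<in> sets P" "1 - \<eta> \<le> measure P E"
      and E_emb: "\<And>S i. S \<in> E \<Longrightarrow> i \<in> I \<Longrightarrow> subspace_embedding \<epsilon> S
             (vec_space.col_space n (aug (bp_hat (c S i)) (W_hat (c S i))))"
      using emb unfolding with_prob_def by (elim bexE conjE) simp
    have \<theta>: "0 \<le> u * p n s m"
      using u dim_poly_nonneg[OF p] by simp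
    have Q: "u * q n s m = 4000 * \<rho> * real m * (u * p n s m)"
      by (simp add: q_def)
    have "backward_error A b (x S (i + 1)) \<le> u * q n s m \<or>
               (ereal (vnorm (residual A b (x S (i + 1)))) \<le>
                  Lambda1 (u * q n s m) \<epsilon> A M\<^sub>L (c S i) * ereal (vnorm (residual A b (x S i))) \<and>
                (residual_scale A b (x S i) \<le> \<rho> * residual_scale A b (x S (i + 1)) \<longrightarrow>
                 ereal (backward_error A b (x S (i + 1))) \<le>
                  Lambda1 (u * q n s m) \<epsilon> A M\<^sub>L (c S i) * ereal (backward_error A b (x S i))))"
      if S: "S \<in> E" and i: "i \<in> I" and \<Lambda>: "Lambda1 (u * q n s m) \<epsilon> A M\<^sub>L (c S i) \<le> ereal (1 / 2)" for S i
    proof -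
      have SP: "S \<in> space P" and i1: "1 \<le> i" "1 \<le> i + 1"
        using S E(1) sets.sets_into_space i I by auto
      have Sc: "S \<in> carrier_mat s n"
        using SP P by blast
      note now = cycles[rule_format, OF SP i1(1)] and nxt = cycles[rule_format, OF SP i1(2)]
      show ?thesis
        by (rule cycle_reduces_backward_error[OF n \<epsilon> \<rho> \<theta> A b M Sc _ _ _ _ _ _ Q _ E_emb[OF S i] \<Lambda>])
          (use now nxt in simp_all)
    qed
    then show "with_prob P \<eta> (\<lambda>S. \<forall>i\<in>I.
             Lambda1 (u * q n s m) \<epsilon> A M\<^sub>L (c S i) \<le> ereal (1 / 2) \<longrightarrow>
               backward_error A b (x S (i + 1)) \<le> u * q n s m \<or>
               (ereal (vnorm (residual A b (x S (i + 1)))) \<le>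
                  Lambda1 (u * q n s m) \<epsilon> A M\<^sub>L (c S i) * ereal (vnorm (residual A b (x S i))) \<and>
                (residual_scale A b (x S i) \<le> \<rho> * residual_scale A b (x S (i + 1)) \<longrightarrow>
                 ereal (backward_error A b (x S (i + 1))) \<le>
                  Lambda1 (u * q n s m) \<epsilon> A M\<^sub>L (c S i) * ereal (backward_error A b (x S i)))))"
      unfolding with_prob_def using E by (intro bexI[of _ E] conjI ballI impI) simp_all
  qed
qed simp_all

end
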